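(* Let $\mathcal A$ and $\mathcal B$ be finite-dimensional von Neumann algebras with faithful tracial positive linear functionals $\tau$ and $\tau_{\mathcal B}$, respectively. Let $\sigma\in\mathcal A$ be the density matrix (with respect to $\tau$) of a faithful state on $\mathcal A$. Let $0\ne V\in\mathcal B$ and let $(\ell,r)$ and $(\ell_*,r_* )$ be two pairs of $(\tau,\tau_{\mathcal B})$-compatible unital $*$-homomorphisms from $\mathcal A$ to $\mathcal B$. Suppose that $$\tau_{\mathcal B}[V^*\ell(A_1)Vr(A_2)]=\tau_{\mathcal B}[V^*r_*(A_1)V\ell_*(A_2)]\qquad\text{for all }A_1,A_2\in\mathcal A,$$ and that there are $\omega,\omega_*\in\mathbb R$ such that $$\ell(\sigma)Vr(\sigma)^{-1}=e^{-\omega}V\qquad\text{and}\qquad \ell_*(\sigma)V^*r_*(\sigma)^{-1}=e^{-\omega_*}V^*.$$ Define $\partial_VA:=Vr(A)-\ell(A)V$ and $\partial_{V^*}A:=V^*r_*(A)-\ell_*(A)V^*$ for $A\in\mathcal A$, and $$\mathscr E(A_1,A_2):=\tau_{\mathcal B}\big[(\partial_VA_1)^*\ell(\sigma^{1/2})(\partial_VA_2)r(\sigma^{1/2})\big]+\tau_{\mathcal B}\big[(\partial_{V^*}A_1)^*\ell_*(\sigma^{1/2})(\partial_{V^*}A_2)r_*(\sigma^{1/2})\big].$$ Then the sesquilinear form $\mathscr E:\mathcal A\times\mathcal A\to\mathbb C$ defines a conservative completely Dirichlet form on $L^2_{\rm KMS}(\mathcal A_h,\sigma)$.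
   Context: A unital $*$-homomorphism $\ell:\mathcal A\to\mathcal B$ is $(\tau,\tau_{\mathcal B})$-compatible if $\tau_{\mathcal B}[\ell(A)]=\tau[A]$ for all $A\in\mathcal A$. The density matrix of a faithful state is an invertible positive $\sigma\in\mathcal A$ with $\tau[\sigma]=1$, the state being $A\mapsto\tau[\sigma A]$. $\mathcal A_h$ is the real vector space of self-adjoint elements of $\mathcal A$, and $L^2_{\rm KMS}(\mathcal A_h,\sigma)$ is $\mathcal A_h$ with the real inner product $\langle A,B\rangle_{L^2_{\rm KMS}(\sigma)}=\tau[A^*\sigma^{1/2}B\sigma^{1/2}]$. The cone of positive semidefinite elements of $\mathcal A$ is self-dual for this inner product. Dirichlet form: let $\mathcal H$ be a finite-dimensional real Hilbert space with self-dual cone $\mathscr C$. Each $\phi\in\mathcal H$ has a unique decomposition $\phi=\phi_+-\phi_-$ with $\phi_\pm\in\mathscr C$ and $\langle\phi_+,\phi_-\rangle=0$. A non-negative symmetric real bilinear form $\mathscr E$ on $\mathcal H$ is a Dirichlet form if $\mathscr E(\phi_+,\phi_-)\le0$ for all $\phi\in\mathcal H$ (equivalently $\mathscr E(|\phi|,|\phi|)\le\mathscr E(\phi,\phi)$ with $|\phi|=\phi_++\phi_-$). Here $\mathcal H=L^2_{\rm KMS}(\mathcal A_h,\sigma)$ and $\mathscr C$ is the cone of positive semidefinite elements; the bilinear form is the restriction of $\mathscr E$ to $\mathcal A_h$. Conservative: $\mathscr E(A,\mathbf 1)=0$ for all $A\in\mathcal A_h$ (equivalently for all $A\in\mathcal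 A$). Completely Dirichlet: for every $m\in\mathbb N$ the form $\mathscr E^{(m)}(\mathbf A,\mathbf B)=\frac1m\sum_{i,j=1}^m\mathscr E(A_{ij},B_{ij})$, for $\mathbf A=\sum A_{ij}\otimes E_{ij}$ and $\mathbf B=\sum B_{ij}\otimes E_{ij}$ self-adjoint in $\mathcal A\otimes M_m(\mathbb C)$ ($E_{ij}$ the matrix units), is a Dirichlet form on the self-adjoint part of $\mathcal A\otimes M_m(\mathbb C)$, equipped with the KMS inner product $\frac1m\sum_{i,j}\langle A_{ij},B_{ij}\rangle_{L^2_{\rm KMS}(\sigma)}$ and the cone of positive semidefinite elements. *)

theory Defs
  imports "HOL-Analysis.Analysis" "HOL-Library.Function_Algebras"
begin

section \<open>Complex Hilbert spaces and their bounded operators\<close>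

text \<open>The inner product is conjugate-linear in its first argument.\<close>

class chilbert_space = banach +
  fixes scaleC :: "complex \<Rightarrow> 'a \<Rightarrow> 'a"
    and cinner :: "'a \<Rightarrow> 'a \<Rightarrow> complex"
  assumes scaleC_add_right: "scaleC a (x + y) = scaleC a x + scaleC a y"
    and scaleC_add_left: "scaleC (a + b) x = scaleC a x + scaleC b x"
    and scaleC_scaleC: "scaleC a (scaleC b x) = scaleC (a * b) x"
    and scaleC_of_real: "scaleC (complex_of_real t) x = t *\<^sub>R x"
    and cinner_commute: "cinner x y = cnj (cinner y x)"
    and cinner_add_right: "cinner x (y + z) = cinner x y + cinner x z"
    and cinner_scaleC_right: "cinner x (scaleC a y) = a * cinner x y"
    and cinner_self: "cinner x x = complex_of_real ((norm x)\<^sup>2)"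

text \<open>Operators are taken from the library type of bounded real-linear maps;
  \<open>complex_linear\<close> singles out the bounded operators of the complex Hilbert space.\<close>

type_synonym 'h op = "'h \<Rightarrow>\<^sub>L 'h"

definition complex_linear :: "'h::chilbert_space op \<Rightarrow> bool" where
  "complex_linear X \<longleftrightarrow> (\<forall>c x. blinfun_apply X (scaleC c x) = scaleC c (blinfun_apply X x))"

abbreviation op_mult :: "'h::chilbert_space op \<Rightarrow> 'h op \<Rightarrow> 'h op" (infixl "\<cdot>" 70) where
  "X \<cdot> Y \<equiv> blinfun_compose X Y"

abbreviation op_one :: "'h::chilbert_space op" ("\<one>") where
  "\<one> \<equiv> id_blinfun"

definition op_scaleC :: "complex \<Rightarrow> 'h::chilbert_space op \<Rightarrow> 'h op" where
  "op_scaleC c X = Blinfun (\<lambda>x. scaleC c (blinfun_apply X x))"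

definition is_adjoint :: "'h::chilbert_space op \<Rightarrow> 'h op \<Rightarrow> bool" where
  "is_adjoint X Y \<longleftrightarrow>
     (\<forall>x y. cinner (blinfun_apply X x) y = cinner x (blinfun_apply Y y))"

definition adj :: "'h::chilbert_space op \<Rightarrow> 'h op" ("_\<^sup>\<dagger>" [1000] 1000) where
  "X\<^sup>\<dagger> = (THE Y. is_adjoint X Y)"

definition op_inverse :: "'h::chilbert_space op \<Rightarrow> 'h op" where
  "op_inverse X = (THE Y. X \<cdot> Y = \<one> \<and> Y \<cdot> X = \<one>)"

definition psd :: "'h::chilbert_space op \<Rightarrow> bool" where
  "psd X \<longleftrightarrow> complex_linear X \<and>
     (\<forall>x. cinner x (blinfun_apply X x) \<in> \<real> \<and> 0 \<le> Re (cinner x (blinfun_apply X x)))"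

definition op_sqrt :: "'h::chilbert_space op \<Rightarrow> 'h op" where
  "op_sqrt X = (THE Y. psd Y \<and> Y \<cdot> Y = X)"


section \<open>Finite-dimensional von Neumann algebras, traces, homomorphisms\<close>

definition commutant :: "'h::chilbert_space op set \<Rightarrow> 'h op set" where
  "commutant S = {Y. complex_linear Y \<and> (\<forall>X\<in>S. X \<cdot> Y = Y \<cdot> X)}"

definition von_neumann_algebra :: "'h::chilbert_space op set \<Rightarrow> bool" where
  "von_neumann_algebra M \<longleftrightarrow>
     (\<forall>X\<in>M. complex_linear X) \<and>
     (\<forall>X\<in>M. \<exists>Y\<in>M. is_adjoint X Y) \<and>
     commutant (commutant M) = M"

text \<open>The Hilbert space itself may be infinite-dimensional.\<close>

definition fd_von_neumann_algebra :: "'h::chilbert_space op set \<Rightarrow> bool" where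
  "fd_von_neumann_algebra M \<longleftrightarrow> von_neumann_algebra M \<and>
     (\<exists>S. finite S \<and> S \<subseteq> M \<and> (\<forall>X\<in>M. \<exists>c. X = (\<Sum>Y\<in>S. op_scaleC (c Y) Y)))"

definition faithful_tracial_functional ::
    "'h::chilbert_space op set \<Rightarrow> ('h op \<Rightarrow> complex) \<Rightarrow> bool" where
  "faithful_tracial_functional M \<tau> \<longleftrightarrow>
     (\<forall>X\<in>M. \<forall>Y\<in>M. \<tau> (X + Y) = \<tau> X + \<tau> Y) \<and>
     (\<forall>c. \<forall>X\<in>M. \<tau> (op_scaleC c X) = c * \<tau> X) \<and>
     (\<forall>X\<in>M. psd X \<longrightarrow> \<tau> X \<in> \<real> \<and> 0 \<le> Re (\<tau> X)) \<and>
     (\<forall>X\<in>M. psd X \<and> \<tau> X = 0 \<longrightarrow> X = 0) \<and>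
     (\<forall>X\<in>M. \<forall>Y\<in>M. \<tau> (X \<cdot> Y) = \<tau> (Y \<cdot> X))"

definition faithful_density_matrix ::
    "'h::chilbert_space op set \<Rightarrow> ('h op \<Rightarrow> complex) \<Rightarrow> 'h op \<Rightarrow> bool" where
  "faithful_density_matrix M \<tau> \<sigma> \<longleftrightarrow>
     \<sigma> \<in> M \<and> psd \<sigma> \<and> (\<exists>Y\<in>M. \<sigma> \<cdot> Y = \<one> \<and> Y \<cdot> \<sigma> = \<one>) \<and> \<tau> \<sigma> = 1"

definition unital_star_hom ::
    "'h::chilbert_space op set \<Rightarrow> 'k::chilbert_space op set \<Rightarrow> ('h op \<Rightarrow> 'k op) \<Rightarrow> bool" where
  "unital_star_hom M N f \<longleftrightarrow>
     (\<forall>X\<in>M. f X \<in> N) \<and>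
     (\<forall>X\<in>M. \<forall>Y\<in>M. f (X + Y) = f X + f Y) \<and>
     (\<forall>c. \<forall>X\<in>M. f (op_scaleC c X) = op_scaleC c (f X)) \<and>
     (\<forall>X\<in>M. \<forall>Y\<in>M. f (X \<cdot> Y) = f X \<cdot> f Y) \<and>
     (\<forall>X\<in>M. f (X\<^sup>\<dagger>) = (f X)\<^sup>\<dagger>) \<and>
     f \<one> = \<one>"

definition trace_compatible ::
    "'h::chilbert_space op set \<Rightarrow> ('h op \<Rightarrow> complex) \<Rightarrow> ('k::chilbert_space op \<Rightarrow> complex)
      \<Rightarrow> ('h op \<Rightarrow> 'k op) \<Rightarrow> bool" where
  "trace_compatible M \<tau> \<tau>' f \<longleftrightarrow> (\<forall>X\<in>M. \<tau>' (f X) = \<tau> X)"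


section \<open>Dirichlet forms on a real space with a cone\<close>

instantiation "fun" :: (type, scaleR) scaleR
begin

definition scaleR_fun :: "real \<Rightarrow> ('a \<Rightarrow> 'b) \<Rightarrow> 'a \<Rightarrow> 'b" where
  "scaleR_fun c f = (\<lambda>x. c *\<^sub>R f x)"

instance ..

end

instance "fun" :: (type, real_vector) real_vector
  by standard (auto simp: scaleR_fun_def fun_eq_iff scaleR_add_right scaleR_add_left)

text \<open>\<open>H\<close> is a real subspace with inner product \<open>ip\<close> and self-dual cone \<open>C\<close>. The form \<open>Q\<close>
  and the inner product are complex-valued because below they are restrictions of sesquilinear
  forms; that \<open>Q\<close> takes real values on \<open>H\<close> is part of the definition. In the last clause,
  \<open>p\<close> and \<open>q\<close> are the positive and negative parts of \<open>\<phi>\<close>, which for a self-dual cone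
  exist and are determined by the three conditions listed.\<close>

definition dirichlet_form ::
    "'v::real_vector set \<Rightarrow> ('v \<Rightarrow> 'v \<Rightarrow> complex) \<Rightarrow> 'v set \<Rightarrow> ('v \<Rightarrow> 'v \<Rightarrow> complex) \<Rightarrow> bool" where
  "dirichlet_form H ip C Q \<longleftrightarrow>
     (\<forall>x\<in>H. \<forall>y\<in>H. Q x y \<in> \<real>) \<and>
     (\<forall>x\<in>H. \<forall>y\<in>H. \<forall>z\<in>H. Q (x + y) z = Q x z + Q y z) \<and>
     (\<forall>c. \<forall>x\<in>H. \<forall>y\<in>H. Q (c *\<^sub>R x) y = complex_of_real c * Q x y) \<and>
     (\<forall>x\<in>H. \<forall>y\<in>H. Q x y = Q y x) \<and>
     (\<forall>x\<in>H. 0 \<le> Re (Q x x)) \<and>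
     (\<forall>\<phi>\<in>H. \<forall>p q. p \<in> C \<and> q \<in> C \<and> \<phi> = p - q \<and> ip p q = 0 \<longrightarrow> Re (Q p q) \<le> 0)"


section \<open>KMS inner product, matrix amplifications, complete Dirichlet property\<close>

definition self_adjoint_part :: "'h::chilbert_space op set \<Rightarrow> 'h op set" where
  "self_adjoint_part M = {X\<in>M. X\<^sup>\<dagger> = X}"

definition kms_inner ::
    "('h::chilbert_space op \<Rightarrow> complex) \<Rightarrow> 'h op \<Rightarrow> 'h op \<Rightarrow> 'h op \<Rightarrow> complex" where
  "kms_inner \<tau> \<sigma> X Y = \<tau> (X\<^sup>\<dagger> \<cdot> op_sqrt \<sigma> \<cdot> Y \<cdot> op_sqrt \<sigma>)"

text \<open>The element \<open>\<Sum>i j. F i j \<otimes> E\<^sub>i\<^sub>j\<close> of \<open>M \<otimes> M\<^sub>m(\<complex>)\<close> is encoded as the function \<open>F\<close>,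
  with indices \<open>0, \<dots>, m - 1\<close> and value \<open>0\<close> outside this range, so that addition and
  scaling of functions are those of the algebra. It acts on the direct sum of \<open>m\<close> copies
  of the Hilbert space by \<open>(F v)\<^sub>i = \<Sum>j. F i j v\<^sub>j\<close>.\<close>

definition matrices_over ::
    "nat \<Rightarrow> 'h::chilbert_space op set \<Rightarrow> (nat \<Rightarrow> nat \<Rightarrow> 'h op) set" where
  "matrices_over m M =
     {F. (\<forall>i<m. \<forall>j<m. F i j \<in> M) \<and> (\<forall>i j. \<not> (i < m \<and> j < m) \<longrightarrow> F i j = 0)}"

definition matrices_self_adjoint ::
    "nat \<Rightarrow> 'h::chilbert_space op set \<Rightarrow> (nat \<Rightarrow> nat \<Rightarrow> 'h op) set" where
  "matrices_self_adjoint m M =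
     {F \<in> matrices_over m M. \<forall>i<m. \<forall>j<m. (F j i)\<^sup>\<dagger> = F i j}"

definition matrices_psd ::
    "nat \<Rightarrow> 'h::chilbert_space op set \<Rightarrow> (nat \<Rightarrow> nat \<Rightarrow> 'h op) set" where
  "matrices_psd m M =
     {F \<in> matrices_over m M. \<forall>v :: nat \<Rightarrow> 'h.
        (\<Sum>i<m. cinner (v i) (\<Sum>j<m. blinfun_apply (F i j) (v j))) \<in> \<real> \<and>
        0 \<le> Re (\<Sum>i<m. cinner (v i) (\<Sum>j<m. blinfun_apply (F i j) (v j)))}"

definition amplification ::
    "nat \<Rightarrow> ('h::chilbert_space op \<Rightarrow> 'h op \<Rightarrow> complex)
      \<Rightarrow> (nat \<Rightarrow> nat \<Rightarrow> 'h op) \<Rightarrow> (nat \<Rightarrow> nat \<Rightarrow> 'h op) \<Rightarrow> complex" where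
  "amplification m Q F G = (1 / of_nat m) * (\<Sum>i<m. \<Sum>j<m. Q (F i j) (G i j))"

text \<open>The case \<open>m = 1\<close> is the Dirichlet property on the self-adjoint part of \<open>M\<close> itself.\<close>

definition completely_dirichlet ::
    "'h::chilbert_space op set \<Rightarrow> ('h op \<Rightarrow> complex) \<Rightarrow> 'h op
      \<Rightarrow> ('h op \<Rightarrow> 'h op \<Rightarrow> complex) \<Rightarrow> bool" where
  "completely_dirichlet M \<tau> \<sigma> Q \<longleftrightarrow>
     (\<forall>m\<ge>1. dirichlet_form (matrices_self_adjoint m M) (amplification m (kms_inner \<tau> \<sigma>))
        (matrices_psd m M) (amplification m Q))"

definition conservative ::
    "'h::chilbert_space op set \<Rightarrow> ('h op \<Rightarrow> 'h op \<Rightarrow> complex) \<Rightarrow> bool" where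
  "conservative M Q \<longleftrightarrow> (\<forall>X\<in>self_adjoint_part M. Q X \<one> = 0)"

definition sesquilinear_on ::
    "'h::chilbert_space op set \<Rightarrow> ('h op \<Rightarrow> 'h op \<Rightarrow> complex) \<Rightarrow> bool" where
  "sesquilinear_on M Q \<longleftrightarrow>
     (\<forall>X\<in>M. \<forall>Y\<in>M. \<forall>Z\<in>M. Q (X + Y) Z = Q X Z + Q Y Z \<and> Q Z (X + Y) = Q Z X + Q Z Y) \<and>
     (\<forall>c. \<forall>X\<in>M. \<forall>Y\<in>M. Q (op_scaleC c X) Y = cnj c * Q X Y \<and>
                         Q X (op_scaleC c Y) = c * Q X Y)"


section \<open>The form attached to a pair of twisted commutators\<close>

definition twisted_deriv ::
    "'k::chilbert_space op \<Rightarrow> ('h::chilbert_space op \<Rightarrow> 'k op) \<Rightarrow> ('h op \<Rightarrow> 'k op)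
      \<Rightarrow> 'h op \<Rightarrow> 'k op" where
  "twisted_deriv V l r X = V \<cdot> r X - l X \<cdot> V"

definition half_energy ::
    "('k::chilbert_space op \<Rightarrow> complex) \<Rightarrow> 'h::chilbert_space op \<Rightarrow> 'k op
      \<Rightarrow> ('h op \<Rightarrow> 'k op) \<Rightarrow> ('h op \<Rightarrow> 'k op) \<Rightarrow> 'h op \<Rightarrow> 'h op \<Rightarrow> complex" where
  "half_energy \<tau>' \<sigma> V l r X Y =
     \<tau>' ((twisted_deriv V l r X)\<^sup>\<dagger> \<cdot> l (op_sqrt \<sigma>) \<cdot> twisted_deriv V l r Y \<cdot> r (op_sqrt \<sigma>))"

definition energy ::
    "('k::chilbert_space op \<Rightarrow> complex) \<Rightarrow> 'h::chilbert_space op \<Rightarrow> 'k op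
      \<Rightarrow> ('h op \<Rightarrow> 'k op) \<Rightarrow> ('h op \<Rightarrow> 'k op) \<Rightarrow> ('h op \<Rightarrow> 'k op) \<Rightarrow> ('h op \<Rightarrow> 'k op)
      \<Rightarrow> 'h op \<Rightarrow> 'h op \<Rightarrow> complex" where
  "energy \<tau>' \<sigma> V l r l' r' X Y =
     half_energy \<tau>' \<sigma> V l r X Y + half_energy \<tau>' \<sigma> (V\<^sup>\<dagger>) l' r' X Y"

end

theory Submission
  imports Defs
begin

text \<open>Write \<open>S = \<sigma>\<^sup>1\<^sup>/\<^sup>2\<close>. Everything is expressed through the correlation form
  \<open>corr V X Y = \<tau>\<^sub>B (V\<^sup>\<dagger> l(X) V r(Y))\<close>. The eigenvalue relation for \<open>\<sigma>\<close> passes to the square root,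
  \<open>l(S) V = c V r(S)\<close> with \<open>c = exp (- \<omega> / 2)\<close> (\<open>sqrt_intertwines\<close>: the defect \<open>D\<close> of this
  relation solves the Sylvester equation \<open>l(S) D + c D r(S) = 0\<close>, which the faithful trace forces
  to be trivial). Moving \<open>S\<close> across \<open>V\<close> in the expanded energy of one commutator gives
  (\<open>en_expand\<close>)
  \<open>c corr V \<one> (S Y S X\<^sup>\<dagger>) + c\<^sup>-\<^sup>1 corr V (X\<^sup>\<dagger> S Y S) \<one> - c corr V Y (S X\<^sup>\<dagger> S) - c corr V X\<^sup>\<dagger> (S Y S)\<close>.

  The sign condition already holds for each commutator separately. If \<open>P\<close> and \<open>Q\<close> are positive
  matrices over the algebra that are orthogonal for the KMS inner product, then
  \<open>\<Sum>i j. P\<^sub>j\<^sub>i S Q\<^sub>i\<^sub>j = 0\<close> (\<open>orthogonal_psd_product_zero\<close>), which kills the first two terms after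
  summation. The last two are minus sums of the shape \<open>\<Sum>i j. corr W P\<^sub>i\<^sub>j Q\<^sub>j\<^sub>i\<close>, and these are
  non-negative for positive \<open>P\<close> and \<open>Q\<close> (\<open>corr_positive\<close>): up to a small multiple of the identity
  both are sums of matrices \<open>z\<^sub>i\<^sup>\<dagger> z\<^sub>j\<close> with entries in the algebra (\<open>cholesky\<close>), and for such
  matrices the sum is the trace of a square. Positivity of homomorphisms on matrices is thereby
  built into the decomposition.

  The second commutator is needed for the form to be real on self-adjoint elements. The conjugacy
  hypothesis exchanges the arguments of the correlation form, and evaluated at \<open>\<sigma>\<close> it forces
  \<open>\<omega>' = - \<omega>\<close> (\<open>twists_reciprocal\<close>). The first two terms of one energy and the corresponding ones of
  the other then combine into complex conjugate pairs (\<open>E_adj\<close>).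

  The square root of an invertible positive element, with its uniqueness and its membership in the
  algebra, comes from a contraction: \<open>Y = (X + Y\<^sup>2) / 2\<close> says that \<open>(\<one> - Y)\<^sup>2 = \<one> - X\<close>.\<close>

section \<open>The inner product and the operator calculus\<close>

lemma cinner_scaleC_left: "cinner (scaleC a x) y = cnj a * cinner x y"
  for x y :: "'a::chilbert_space"
  by (metis cinner_commute cinner_scaleC_right complex_cnj_mult)

lemma cinner_add_left: "cinner (x + y) z = cinner x z + cinner y z"
  for x y z :: "'a::chilbert_space"
  by (metis cinner_commute cinner_add_right complex_cnj_add)

lemma cinner_scaleR_right: "cinner x (t *\<^sub>R y) = complex_of_real t * cinner x y"
  for x y :: "'a::chilbert_space"
  by (metis cinner_scaleC_right scaleC_of_real)

lemma cinner_scaleR_left: "cinner (t *\<^sub>R x) y = complex_of_real t * cinner x y"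
  for x y :: "'a::chilbert_space"
  by (metis cinner_scaleC_left complex_cnj_complex_of_real scaleC_of_real)

lemma cinner_zero [simp]:
  fixes x :: "'a::chilbert_space"
  shows "cinner x 0 = 0" "cinner 0 x = 0"
  using cinner_scaleR_right[of x 0 x] cinner_scaleR_left[of 0 x x] by simp_all

lemma cinner_minus_right: "cinner x (- y) = - cinner x y"
  for x y :: "'a::chilbert_space"
  using cinner_scaleR_right[of x "-1" y] by simp

lemma cinner_minus_left: "cinner (- x) y = - cinner x y"
  for x y :: "'a::chilbert_space"
  using cinner_scaleR_left[of "-1" x y] by simp

lemma cinner_diff_right: "cinner x (y - z) = cinner x y - cinner x z"
  for x y z :: "'a::chilbert_space"
  using cinner_add_right[of x y "-z"] by (simp add: cinner_minus_right)

lemma cinner_diff_left: "cinner (x - y) z = cinner x z - cinner y z"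
  for x y z :: "'a::chilbert_space"
  using cinner_add_left[of x "-y" z] by (simp add: cinner_minus_left)

lemma cinner_eqI: "x = y" if "\<And>z. cinner z x = cinner z y" for x y :: "'a::chilbert_space"
proof -
  have "cinner (x - y) (x - y) = 0" using that by (simp add: cinner_diff_right)
  then show ?thesis by (simp add: cinner_self)
qed

lemma norm_scaleC: "norm (scaleC a x) = cmod a * norm x" for x :: "'a::chilbert_space"
proof -
  have "complex_of_real ((norm (scaleC a x))\<^sup>2) = cnj a * a * cinner x x"
    by (simp only: cinner_self[symmetric] cinner_scaleC_left cinner_scaleC_right mult_ac)
  also have "\<dots> = complex_of_real ((cmod a * norm x)\<^sup>2)"
    by (simp add: cinner_self power_mult_distrib complex_norm_square mult.commute
          del: of_real_power)
  finally have "(norm (scaleC a x))\<^sup>2 = (cmod a * norm x)\<^sup>2" by (simp only: of_real_eq_iff)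
  then show ?thesis by (simp add: power2_eq_iff_nonneg)
qed

lemma bounded_linear_scaleC: "bounded_linear (scaleC a :: 'a::chilbert_space \<Rightarrow> 'a)"
proof (rule bounded_linear_intro[where K = "cmod a"])
  show "scaleC a (t *\<^sub>R x) = t *\<^sub>R scaleC a x" for t and x :: 'a
    by (metis scaleC_of_real scaleC_scaleC mult.commute)
qed (auto simp: scaleC_add_right norm_scaleC)

lemma op_scaleC_apply [simp]: "blinfun_apply (op_scaleC c X) x = scaleC c (blinfun_apply X x)"
  unfolding op_scaleC_def
  by (subst bounded_linear_Blinfun_apply)
     (auto intro: bounded_linear_compose[OF bounded_linear_scaleC] blinfun.bounded_linear_right)

lemma scaleC_scaleR: "scaleC c (t *\<^sub>R x) = t *\<^sub>R scaleC c x" for x :: "'a::chilbert_space"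
  by (metis scaleC_of_real scaleC_scaleC mult.commute)

lemma scaleC_diff_right: "scaleC c (x - y) = scaleC c x - scaleC c y" for x :: "'a::chilbert_space"
  using linear_diff[OF bounded_linear.linear[OF bounded_linear_scaleC]] .

lemma scaleC_zero_right [simp]: "scaleC c (0::'a::chilbert_space) = 0"
  using linear_0[OF bounded_linear.linear[OF bounded_linear_scaleC]] .

lemma scaleR_eq_op_scaleC: "t *\<^sub>R X = op_scaleC (complex_of_real t) X"
  by (rule blinfun_eqI) (simp add: scaleC_of_real blinfun.scaleR_left)

interpretation compose: bounded_bilinear "blinfun_compose :: 'b::real_normed_vector \<Rightarrow>\<^sub>L 'c::real_normed_vector \<Rightarrow> 'a::real_normed_vector \<Rightarrow>\<^sub>L 'b \<Rightarrow> 'a \<Rightarrow>\<^sub>L 'c"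
  by (rule bounded_bilinear_blinfun_compose)

lemmas op_distribs =
  compose.add_left compose.add_right
  compose.diff_left compose.diff_right
  compose.minus_left compose.minus_right
  compose.scaleR_left compose.scaleR_right
  compose.sum_left compose.sum_right

lemma op_assoc: "X \<cdot> Y \<cdot> Z = X \<cdot> (Y \<cdot> Z)"
  by (rule blinfun_eqI) simp

lemma op_one_left [simp]: "\<one> \<cdot> X = X" and op_one_right [simp]: "X \<cdot> \<one> = X"
  by (auto intro: blinfun_eqI)

lemma op_scaleC_left: "op_scaleC c X \<cdot> Y = op_scaleC c (X \<cdot> Y)"
  by (rule blinfun_eqI) simp

lemma op_scaleC_right: "complex_linear X \<Longrightarrow> X \<cdot> op_scaleC c Y = op_scaleC c (X \<cdot> Y)"
  by (rule blinfun_eqI) (simp add: complex_linear_def)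

lemma complex_linear_closure:
  "complex_linear \<one>" "complex_linear 0"
  "complex_linear X \<Longrightarrow> complex_linear Y \<Longrightarrow> complex_linear (X + Y)"
  "complex_linear X \<Longrightarrow> complex_linear Y \<Longrightarrow> complex_linear (X - Y)"
  "complex_linear X \<Longrightarrow> complex_linear Y \<Longrightarrow> complex_linear (X \<cdot> Y)"
  "complex_linear X \<Longrightarrow> complex_linear (op_scaleC c X)"
  "complex_linear X \<Longrightarrow> complex_linear (t *\<^sub>R X)"
  by (auto simp: complex_linear_def blinfun.bilinear_simps scaleC_add_right scaleC_diff_right
      scaleC_scaleC mult.commute scaleC_scaleR)


section \<open>Positive operators and the Cauchy--Schwarz inequality\<close>

lemma is_adjoint_commute: "is_adjoint X Y \<longleftrightarrow> is_adjoint Y X"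
  unfolding is_adjoint_def by (metis cinner_commute)

lemma is_adjoint_unique: "is_adjoint X Y \<Longrightarrow> is_adjoint X Z \<Longrightarrow> Y = Z"
  unfolding is_adjoint_def by (intro blinfun_eqI cinner_eqI) metis

lemma adj_eqI: "is_adjoint X Y \<Longrightarrow> X\<^sup>\<dagger> = Y"
  unfolding adj_def by (blast intro: the_equality is_adjoint_unique)

lemma is_adjoint_compose: "is_adjoint X Y \<Longrightarrow> is_adjoint Z W \<Longrightarrow> is_adjoint (X \<cdot> Z) (W \<cdot> Y)"
  unfolding is_adjoint_def by simp

lemma is_adjoint_add: "is_adjoint X Y \<Longrightarrow> is_adjoint Z W \<Longrightarrow> is_adjoint (X + Z) (Y + W)"
  unfolding is_adjoint_def by (simp add: blinfun.bilinear_simps cinner_add_left cinner_add_right)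

lemma is_adjoint_diff: "is_adjoint X Y \<Longrightarrow> is_adjoint Z W \<Longrightarrow> is_adjoint (X - Z) (Y - W)"
  unfolding is_adjoint_def by (simp add: blinfun.bilinear_simps cinner_diff_left cinner_diff_right)

lemma is_adjoint_scaleC: "is_adjoint X Y \<Longrightarrow> is_adjoint (op_scaleC c X) (op_scaleC (cnj c) Y)"
  unfolding is_adjoint_def by (simp add: cinner_scaleC_left cinner_scaleC_right)

lemma is_adjoint_scaleR: "is_adjoint X Y \<Longrightarrow> is_adjoint (t *\<^sub>R X) (t *\<^sub>R Y)"
  unfolding is_adjoint_def by (simp add: blinfun.bilinear_simps cinner_scaleR_left cinner_scaleR_right)

lemma is_adjoint_one: "is_adjoint \<one> \<one>" and is_adjoint_zero: "is_adjoint 0 0"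
  unfolding is_adjoint_def by simp_all

text \<open>The arithmetic of polarization: for a form with real diagonal values, \<open>p = \<langle>x, X y\<rangle>\<close> and
  \<open>q = \<langle>y, X x\<rangle>\<close> satisfy both conditions, the second one through \<open>y \<mapsto> \<i> y\<close>.\<close>

lemma cnj_swap_if_real_quadratic:
  fixes p q :: complex
  assumes "p + q \<in> \<real>" and "\<i> * p - \<i> * q \<in> \<real>"
  shows "p = cnj q"
  using assms by (auto simp: complex_is_Real_iff complex_eq_iff)

lemma real_form_selfadjoint:
  assumes "complex_linear X" and re: "\<And>u. cinner u (blinfun_apply X u) \<in> \<real>"
  shows "is_adjoint X X"
  unfolding is_adjoint_def
proof (intro allI)
  fix x y :: 'a
  have lin: "blinfun_apply X (scaleC c u) = scaleC c (blinfun_apply X u)" for c u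
    using assms(1) by (simp add: complex_linear_def)
  have "cinner x (X y) + cinner y (X x) = cinner (x + y) (X (x + y)) - cinner x (X x) - cinner y (X y)"
    by (simp add: blinfun.bilinear_simps cinner_add_left cinner_add_right)
  then have 1: "cinner x (X y) + cinner y (X x) \<in> \<real>" using re by (metis Reals_diff)
  have "\<i> * cinner x (X y) - \<i> * cinner y (X x) =
    cinner (x + scaleC \<i> y) (X (x + scaleC \<i> y)) - cinner x (X x) - cinner y (X y)"
    by (simp add: blinfun.bilinear_simps cinner_add_left cinner_add_right lin
        cinner_scaleC_left cinner_scaleC_right algebra_simps)
  then have 2: "\<i> * cinner x (X y) - \<i> * cinner y (X x) \<in> \<real>" using re by (metis Reals_diff)
  show "cinner (X x) y = cinner x (X y)"
    using cnj_swap_if_real_quadratic[OF 1 2] by (metis cinner_commute)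
qed

lemma psd_selfadjoint: "psd X \<Longrightarrow> is_adjoint X X"
  by (intro real_form_selfadjoint) (simp_all add: psd_def)

lemma psd_one: "psd \<one>"
  by (auto simp: psd_def complex_linear_closure cinner_self)

text \<open>Used with the form of \<open>X\<close> instead of the inner product, this bounds \<open>X x\<close> by \<open>\<langle>x, X x\<rangle>\<close>; in
  particular \<open>X x = 0\<close> as soon as \<open>\<langle>x, X x\<rangle> = 0\<close>.\<close>

lemma psd_Cauchy_Schwarz:
  assumes "psd X"
  shows "(cmod (cinner x (blinfun_apply X y)))\<^sup>2 \<le>
    Re (cinner x (blinfun_apply X x)) * Re (cinner y (blinfun_apply X y))"
proof -
  define b where "b = cinner x (X y)"
  define q where "q u = Re (cinner u (X u))" for u
  have lin: "blinfun_apply X (scaleC c u) = scaleC c (blinfun_apply X u)" for c u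
    using assms by (simp add: psd_def complex_linear_def)
  have q0: "0 \<le> q u" for u using assms by (simp add: psd_def q_def)
  have yx: "cinner y (X x) = cnj b"
    using psd_selfadjoint[OF assms] unfolding is_adjoint_def b_def by (metis cinner_commute)
  \<comment> \<open>Evaluate the form at \<open>x + z y\<close>, with the phase of \<open>z\<close> chosen so that the cross term is
    negative; the best modulus corresponds to \<open>s = 1 / q y\<close>.\<close>
  have main: "0 \<le> q x - 2 * s * (cmod b)\<^sup>2 + s\<^sup>2 * (cmod b)\<^sup>2 * q y" for s :: real
  proof -
    define z where "z = - (complex_of_real s * cnj b)"
    have "cinner (x + scaleC z y) (X (x + scaleC z y)) =
      cinner x (X x) + (z * b + cnj (z * b)) + cnj z * z * cinner y (X y)"
      by (simp add: blinfun.bilinear_simps cinner_add_left cinner_add_right lin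
        cinner_scaleC_left cinner_scaleC_right algebra_simps yx b_def[symmetric])
    then have "q (x + scaleC z y) = q x + 2 * Re (z * b) + Re (cnj z * z * cinner y (X y))"
      by (simp add: q_def del: mult_minus_left)
    moreover have "z * b = complex_of_real (- s * (cmod b)\<^sup>2)"
      by (simp add: z_def complex_norm_square mult.commute del: of_real_power)
    moreover have "cnj z * z = complex_of_real (s\<^sup>2 * (cmod b)\<^sup>2)"
      by (simp add: z_def power2_eq_square[of s] complex_norm_square del: of_real_power)
    ultimately have "q (x + scaleC z y) = q x - 2 * s * (cmod b)\<^sup>2 + s\<^sup>2 * (cmod b)\<^sup>2 * q y"
      by (simp add: q_def del: of_real_mult of_real_power)
    then show ?thesis using q0 by metis
  qed
  have "(cmod b)\<^sup>2 \<le> q x * q y"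
  proof (cases "q y = 0")
    case True
    show ?thesis
    proof (rule ccontr)
      assume "\<not> ?thesis"
      then have pos: "0 < (cmod b)\<^sup>2" using True by simp
      then show False using main[of "(q x + 1) / (2 * (cmod b)\<^sup>2)"] True by (simp add: field_simps)
    qed
  next
    case False
    then have "0 < q y" using q0[of y] by simp
    then show ?thesis using main[of "1 / q y"] by (simp add: field_simps power2_eq_square)
  qed
  then show ?thesis by (simp add: b_def q_def)
qed

lemma cinner_Cauchy_Schwarz: "cmod (cinner x y) \<le> norm x * norm y" for x y :: "'a::chilbert_space"
proof -
  have "(cmod (cinner x y))\<^sup>2 \<le> (norm x * norm y)\<^sup>2"
    using psd_Cauchy_Schwarz[OF psd_one, of x y]
    by (simp add: cinner_self power_mult_distrib del: of_real_power)
  then show ?thesis by (rule power2_le_imp_le) simp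
qed

lemma bounded_bilinear_cinner: "bounded_bilinear (cinner :: 'a::chilbert_space \<Rightarrow> 'a \<Rightarrow> complex)"
  by (rule bounded_bilinear.intro)
     (auto simp: cinner_add_left cinner_add_right cinner_scaleR_left cinner_scaleR_right
        scaleR_conv_of_real intro!: exI[of _ 1] cinner_Cauchy_Schwarz)

lemma psd_form_zero:
  assumes "psd X" and "Re (cinner x (blinfun_apply X x)) = 0"
  shows "blinfun_apply X x = 0"
  using psd_Cauchy_Schwarz[OF assms(1), of "X x" x] assms(2)
  by (simp add: cinner_self)

lemma psd_scaleR: "psd X \<Longrightarrow> 0 \<le> t \<Longrightarrow> psd (t *\<^sub>R X)"
  by (auto simp: psd_def complex_linear_closure blinfun.bilinear_simps cinner_scaleR_right)

lemma psd_adjoint_mult: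
  assumes "is_adjoint X Y" "complex_linear X" "complex_linear Y"
  shows "psd (Y \<cdot> X)"
proof -
  have "cinner x ((Y \<cdot> X) x) = complex_of_real ((norm (X x))\<^sup>2)" for x
    using assms(1) by (simp add: is_adjoint_def flip: cinner_self del: of_real_power)
  then show ?thesis
    unfolding psd_def by (metis Re_complex_of_real Reals_of_real assms(2,3)
        complex_linear_closure(5) zero_le_power2)
qed

lemma adjoint_mult_zero:
  assumes "is_adjoint X Y" "Y \<cdot> X = 0"
  shows "X = 0"
proof (rule blinfun_eqI)
  fix x
  have "cinner (X x) (X x) = cinner x ((Y \<cdot> X) x)" using assms(1) by (simp add: is_adjoint_def)
  then show "blinfun_apply X x = blinfun_apply 0 x" using assms(2) by (simp add: cinner_self)
qed

section \<open>Inverses and square roots of strictly positive operators\<close>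

text \<open>For positive operators this is equivalent to invertibility. The bound is what contraction
  arguments use, and it passes to homomorphic images, square roots and Schur complements.\<close>

definition strictly_positive :: "'h::chilbert_space op \<Rightarrow> bool" where
  "strictly_positive a \<longleftrightarrow> psd a \<and>
     (\<exists>\<epsilon>>0. \<forall>x. \<epsilon> * (norm x)\<^sup>2 \<le> Re (cinner x (blinfun_apply a x)))"

lemma le_if_square_le_mult: "t \<le> q" if "t * t \<le> t * q" "0 \<le> q" for t q :: real
  using that by (cases "0 < t") auto

text \<open>By Cauchy--Schwarz for the form of \<open>a\<close>, \<open>\<parallel>a x\<parallel>\<^sup>2 \<le> \<parallel>a\<parallel> \<langle>x, a x\<rangle>\<close>, and a left inverse
  bounds \<open>\<parallel>a x\<parallel>\<close> below.\<close>

lemma strictly_positive_if_left_inverse: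
  assumes "psd a" and "J \<cdot> a = \<one>"
  shows "strictly_positive a"
proof -
  define K where "K = norm J + 1"
  define N where "N = norm a + 1"
  have pos: "0 < K" "0 < N" by (auto simp: K_def N_def intro: add_nonneg_pos)
  have "1 / (K\<^sup>2 * N) * (norm x)\<^sup>2 \<le> Re (cinner x (blinfun_apply a x))" for x
  proof -
    let ?q = "Re (cinner x (blinfun_apply a x))"
    have q0: "0 \<le> ?q" using assms(1) by (simp add: psd_def)
    have "norm x = norm (J (a x))" using assms(2) by (metis blinfun_apply_blinfun_compose blinfun_apply_id_blinfun)
    also have "\<dots> \<le> norm J * norm (a x)" by (rule norm_blinfun)
    also have "\<dots> \<le> K * norm (a x)" by (simp add: K_def mult_right_mono)
    finally have 1: "(norm x)\<^sup>2 \<le> K\<^sup>2 * (norm (a x))\<^sup>2"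
      by (metis norm_ge_zero power_mono power_mult_distrib)
    have "Re (cinner (a x) (a (a x))) \<le> norm (a x) * norm (a (a x))"
      using cinner_Cauchy_Schwarz complex_Re_le_cmod order_trans by blast
    also have "\<dots> \<le> norm (a x) * (N * norm (a x))"
      by (intro mult_left_mono order_trans[OF norm_blinfun]) (simp_all add: N_def mult_right_mono)
    finally have "Re (cinner (a x) (a (a x))) * ?q \<le> N * (norm (a x))\<^sup>2 * ?q"
      using q0 by (intro mult_right_mono) (simp_all add: power2_eq_square algebra_simps)
    with psd_Cauchy_Schwarz[OF assms(1), of "a x" x]
    have "(norm (a x))\<^sup>2 * (norm (a x))\<^sup>2 \<le> (norm (a x))\<^sup>2 * (N * ?q)"
      by (simp add: cinner_self power2_eq_square algebra_simps norm_mult)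
    then have "(norm (a x))\<^sup>2 \<le> N * ?q"
      by (rule le_if_square_le_mult) (use q0 pos in simp)
    then have "K\<^sup>2 * (norm (a x))\<^sup>2 \<le> K\<^sup>2 * (N * ?q)" by (intro mult_left_mono) simp_all
    with 1 have "(norm x)\<^sup>2 \<le> K\<^sup>2 * N * ?q" by simp
    then show ?thesis using pos by (simp add: pos_divide_le_eq mult.commute)
  qed
  moreover have "0 < 1 / (K\<^sup>2 * N)" using pos by simp
  ultimately show ?thesis using assms(1) unfolding strictly_positive_def by blast
qed

text \<open>After rescaling, a strictly positive operator is \<open>\<one> - X\<close> with \<open>X\<close> a positive strict
  contraction; this makes its inverse and its square root fixed points of contractions.\<close>

lemma strictly_positive_scaled:
  assumes "strictly_positive a"
  obtains s \<rho> where "0 < s" "0 \<le> \<rho>" "\<rho> < 1" "psd (\<one> - s *\<^sub>R a)" "norm (\<one> - s *\<^sub>R a) \<le> \<rho>"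
proof -
  obtain \<epsilon> where psd: "psd a" and \<epsilon>: "0 < \<epsilon>"
    and below: "\<And>x. \<epsilon> * (norm x)\<^sup>2 \<le> Re (cinner x (blinfun_apply a x))"
    using assms unfolding strictly_positive_def by blast
  define s where "s = 1 / (norm a + \<epsilon>)"
  define \<rho> where "\<rho> = 1 - s * \<epsilon>"
  define X where "X = \<one> - s *\<^sub>R a"
  have n: "0 < norm a + \<epsilon>" using \<epsilon> by (simp add: add_nonneg_pos)
  have s: "0 < s" using n by (simp add: s_def)
  have \<rho>: "0 \<le> \<rho>" "\<rho> < 1" using n s \<epsilon> by (simp_all add: \<rho>_def s_def field_simps)
  have form: "cinner x (X x) = complex_of_real ((norm x)\<^sup>2) - complex_of_real s * cinner x (a x)" for x
    by (simp add: X_def blinfun.bilinear_simps cinner_diff_right cinner_scaleR_right cinner_self)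
  have Re_form: "Re (cinner x (X x)) = (norm x)\<^sup>2 - s * Re (cinner x (a x))" for x
    by (simp add: form del: of_real_power)
  have upper: "Re (cinner x (X x)) \<le> \<rho> * (norm x)\<^sup>2" for x
    using mult_left_mono[OF below[of x], of s] s by (simp add: Re_form \<rho>_def algebra_simps)
  have lower: "0 \<le> Re (cinner x (X x))" for x
  proof -
    have "Re (cinner x (a x)) \<le> norm x * norm (a x)"
      using cinner_Cauchy_Schwarz complex_Re_le_cmod order_trans by blast
    also have "\<dots> \<le> norm x * (norm a * norm x)" by (intro mult_left_mono norm_blinfun) simp
    finally have "s * Re (cinner x (a x)) \<le> s * norm a * (norm x)\<^sup>2"
      using s by (simp add: power2_eq_square mult_left_mono algebra_simps)
    also have "\<dots> \<le> 1 * (norm x)\<^sup>2"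
      using n \<epsilon> by (intro mult_right_mono) (simp_all add: s_def field_simps)
    finally show ?thesis by (simp add: Re_form)
  qed
  have real: "cinner x (X x) \<in> \<real>" for x
    using psd unfolding form psd_def by (auto intro!: Reals_diff Reals_mult)
  have X: "psd X"
    unfolding psd_def using lower real psd
    by (simp add: X_def complex_linear_closure psd_def)
  have "norm X \<le> \<rho>"
  proof (rule norm_blinfun_bound[OF \<rho>(1)])
    fix x
    have "((norm (X x))\<^sup>2)\<^sup>2 \<le> Re (cinner (X x) (X (X x))) * Re (cinner x (X x))"
      using psd_Cauchy_Schwarz[OF X, of "X x" x] by (simp add: cinner_self norm_power)
    also have "\<dots> \<le> (\<rho> * (norm (X x))\<^sup>2) * (\<rho> * (norm x)\<^sup>2)"
      using lower upper \<rho> by (intro mult_mono) simp_all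
    finally have "(norm (X x))\<^sup>2 * (norm (X x))\<^sup>2 \<le> (norm (X x))\<^sup>2 * (\<rho> * norm x)\<^sup>2"
      by (simp add: power2_eq_square algebra_simps)
    then have "(norm (X x))\<^sup>2 \<le> (\<rho> * norm x)\<^sup>2" by (rule le_if_square_le_mult) simp
    then show "norm (X x) \<le> \<rho> * norm x" by (rule power2_le_imp_le) (simp add: \<rho>)
  qed
  then show ?thesis using that s \<rho> X unfolding X_def by blast
qed

text \<open>The sum of the Neumann series is the fixed point of \<open>J \<mapsto> \<one> + X J\<close>; its mirror image gives a
  left inverse, and the two agree.\<close>

lemma one_minus_contraction_invertible:
  fixes X :: "'h::chilbert_space op"
  assumes "norm X \<le> \<rho>" "0 \<le> \<rho>" "\<rho> < 1"
  obtains J where "(\<one> - X) \<cdot> J = \<one>" "J \<cdot> (\<one> - X) = \<one>"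
proof -
  have "dist (\<one> + X \<cdot> J) (\<one> + X \<cdot> K) \<le> \<rho> * dist J K" for J K
  proof -
    have "dist (\<one> + X \<cdot> J) (\<one> + X \<cdot> K) = norm (X \<cdot> (J - K))" by (simp add: dist_norm op_distribs)
    also have "\<dots> \<le> norm X * norm (J - K)" by (rule norm_blinfun_compose)
    also have "\<dots> \<le> \<rho> * norm (J - K)" by (rule mult_right_mono[OF assms(1)]) simp
    finally show ?thesis by (simp add: dist_norm)
  qed
  then obtain J where J: "\<one> + X \<cdot> J = J" using banach_fix_type[OF assms(2,3), of "\<lambda>J. \<one> + X \<cdot> J"] by blast
  have "dist (\<one> + J \<cdot> X) (\<one> + K \<cdot> X) \<le> \<rho> * dist J K" for J K
  proof -
    have "dist (\<one> + J \<cdot> X) (\<one> + K \<cdot> X) = norm ((J - K) \<cdot> X)" by (simp add: dist_norm op_distribs)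
    also have "\<dots> \<le> norm (J - K) * norm X" by (rule norm_blinfun_compose)
    also have "\<dots> \<le> norm (J - K) * \<rho>" by (rule mult_left_mono[OF assms(1)]) simp
    finally show ?thesis by (simp add: dist_norm mult.commute)
  qed
  then obtain K where K: "\<one> + K \<cdot> X = K" using banach_fix_type[OF assms(2,3), of "\<lambda>K. \<one> + K \<cdot> X"] by blast
  have 1: "(\<one> - X) \<cdot> J = \<one>" using J by (simp add: op_distribs algebra_simps)
  have 2: "K \<cdot> (\<one> - X) = \<one>" using K by (simp add: op_distribs algebra_simps)
  have "K = J" using 1 2 by (metis op_assoc op_one_left op_one_right)
  with 1 2 that show ?thesis by blast
qed

lemma strictly_positive_invertible:
  fixes a :: "'h::chilbert_space op"
  assumes "strictly_positive a"
  obtains J where "a \<cdot> J = \<one>" "J \<cdot> a = \<one>"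
proof -
  obtain s \<rho> where s: "0 < s" "0 \<le> \<rho>" "\<rho> < 1" "norm (\<one> - s *\<^sub>R a) \<le> \<rho>"
    using strictly_positive_scaled[OF assms] .
  obtain J where "(\<one> - (\<one> - s *\<^sub>R a)) \<cdot> J = \<one>" "J \<cdot> (\<one> - (\<one> - s *\<^sub>R a)) = \<one>"
    using one_minus_contraction_invertible[OF s(4,2,3)] .
  then have "a \<cdot> (s *\<^sub>R J) = \<one>" "(s *\<^sub>R J) \<cdot> a = \<one>" by (simp_all add: op_distribs)
  with that show ?thesis by blast
qed

lemma closed_commuting: "closed {Y. Z \<cdot> Y = Y \<cdot> Z}"
  by (intro closed_Collect_eq linear_continuous_on
      compose.bounded_linear_left compose.bounded_linear_right)

lemma closed_complex_linear: "closed {X. complex_linear X}"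
  unfolding complex_linear_def
  by (intro closed_Collect_all closed_Collect_eq linear_continuous_on blinfun.bounded_linear_left
      bounded_linear_compose[OF bounded_linear_scaleC blinfun.bounded_linear_left])

lemma closed_selfadjoint: "closed {X. is_adjoint X X}"
  unfolding is_adjoint_def
  by (intro closed_Collect_all closed_Collect_eq linear_continuous_on
      bounded_linear_compose[OF bounded_bilinear.bounded_linear_left[OF bounded_bilinear_cinner]
        blinfun.bounded_linear_left]
      bounded_linear_compose[OF bounded_bilinear.bounded_linear_right[OF bounded_bilinear_cinner]
        blinfun.bounded_linear_left])

text \<open>If \<open>Y = (X + Y\<^sup>2) / 2\<close>, then \<open>(\<one> - Y)\<^sup>2 = \<one> - X\<close>. The right-hand side contracts the ball
  of radius \<open>\<rho>\<close> by the factor \<open>\<rho>\<close>, and the closed set of self-adjoint operators commuting with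
  everything that commutes with \<open>X\<close> is stable under it.\<close>

lemma sqrt_fixed_point:
  assumes X: "complex_linear X" "is_adjoint X X" "norm X \<le> \<rho>" "0 \<le> \<rho>" "\<rho> < 1"
  shows "\<exists>Y. complex_linear Y \<and> is_adjoint Y Y \<and> norm Y \<le> \<rho> \<and>
    (\<forall>Z. Z \<cdot> X = X \<cdot> Z \<longrightarrow> Z \<cdot> Y = Y \<cdot> Z) \<and> (1/2) *\<^sub>R (X + Y \<cdot> Y) = Y"
proof -
  define K where "K = {Y. complex_linear Y} \<inter> {Y. is_adjoint Y Y} \<inter> cball 0 \<rho> \<inter>
    (\<Inter>Z\<in>{Z. Z \<cdot> X = X \<cdot> Z}. {Y. Z \<cdot> Y = Y \<cdot> Z})"
  let ?f = "\<lambda>Y. (1/2) *\<^sub>R (X + Y \<cdot> Y)"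
  have "closed K"
    unfolding K_def
    by (intro closed_Int closed_INT ballI closed_commuting closed_complex_linear closed_selfadjoint
        closed_cball)
  then have "complete K" by (simp add: complete_eq_closed)
  have "0 \<in> K" using X(4) by (simp add: K_def complex_linear_closure is_adjoint_zero)
  have maps: "?f ` K \<subseteq> K"
  proof (rule image_subsetI)
    fix Y assume Y: "Y \<in> K"
    have "norm (?f Y) \<le> (norm X + norm (Y \<cdot> Y)) / 2"
      by (simp add: norm_triangle_ineq)
    also have "norm (Y \<cdot> Y) \<le> norm Y * norm Y" by (rule norm_blinfun_compose)
    also have "\<dots> \<le> \<rho> * 1" using Y X by (intro mult_mono) (auto simp: K_def)
    finally have "norm (?f Y) \<le> \<rho>" using X by simp
    moreover have "Z \<cdot> ?f Y = ?f Y \<cdot> Z" if "Z \<cdot> X = X \<cdot> Z" for Z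
    proof -
      have "Z \<cdot> Y = Y \<cdot> Z" using Y that by (simp add: K_def)
      then have "Z \<cdot> (Y \<cdot> Y) = Y \<cdot> Y \<cdot> Z" by (metis op_assoc)
      then show ?thesis using that by (simp add: op_distribs)
    qed
    moreover have "complex_linear (?f Y)"
      using X Y by (intro complex_linear_closure) (simp_all add: K_def)
    moreover have "is_adjoint (?f Y) (?f Y)"
      using X Y by (intro is_adjoint_scaleR is_adjoint_add is_adjoint_compose) (simp_all add: K_def)
    ultimately show "?f Y \<in> K" unfolding K_def
      by (simp only: Int_iff mem_Collect_eq mem_cball dist_0_norm INT_iff) simp
  qed
  have contr: "dist (?f Y) (?f Z) \<le> \<rho> * dist Y Z" if "Y \<in> K" "Z \<in> K" for Y Z
  proof -
    have "?f Y - ?f Z = (1/2) *\<^sub>R (Y \<cdot> (Y - Z) + (Y - Z) \<cdot> Z)"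
      by (simp add: op_distribs algebra_simps)
    then have "dist (?f Y) (?f Z) = norm (Y \<cdot> (Y - Z) + (Y - Z) \<cdot> Z) / 2"
      by (simp add: dist_norm)
    also have "\<dots> \<le> (norm Y * norm (Y - Z) + norm (Y - Z) * norm Z) / 2"
      by (intro divide_right_mono order_trans[OF norm_triangle_ineq] add_mono norm_blinfun_compose) simp
    also have "\<dots> \<le> (\<rho> * norm (Y - Z) + norm (Y - Z) * \<rho>) / 2"
      using that by (intro divide_right_mono add_mono mult_mono) (auto simp: K_def X(4))
    finally show ?thesis by (simp add: dist_norm)
  qed
  have "K \<noteq> {}" using \<open>0 \<in> K\<close> by auto
  then have "\<exists>!Y. Y \<in> K \<and> ?f Y = Y"
    by (rule Banach_fix[OF \<open>complete K\<close> _ X(4,5) maps contr])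
  then obtain Y where Y: "Y \<in> K" and fp: "?f Y = Y" by (elim ex1E conjE)
  from Y have "complex_linear Y \<and> is_adjoint Y Y \<and> norm Y \<le> \<rho> \<and>
      (\<forall>Z. Z \<cdot> X = X \<cdot> Z \<longrightarrow> Z \<cdot> Y = Y \<cdot> Z)"
    by (simp add: K_def)
  with fp show ?thesis by blast
qed

lemma strictly_positive_sqrt_exists:
  fixes a :: "'h::chilbert_space op"
  assumes "strictly_positive a"
  obtains R where "psd R" "R \<cdot> R = a" "\<And>Z. Z \<cdot> a = a \<cdot> Z \<Longrightarrow> Z \<cdot> R = R \<cdot> Z"
proof -
  obtain s \<rho> where s: "0 < s" "0 \<le> \<rho>" "\<rho> < 1" "psd (\<one> - s *\<^sub>R a)" "norm (\<one> - s *\<^sub>R a) \<le> \<rho>"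
    using strictly_positive_scaled[OF assms] .
  define X where "X = \<one> - s *\<^sub>R a"
  have X: "complex_linear X" "is_adjoint X X" "norm X \<le> \<rho>"
    using s psd_selfadjoint by (auto simp: X_def psd_def)
  obtain Y where Y: "complex_linear Y" "is_adjoint Y Y" "norm Y \<le> \<rho>"
    and Ycomm: "\<And>Z. Z \<cdot> X = X \<cdot> Z \<Longrightarrow> Z \<cdot> Y = Y \<cdot> Z" and fp: "(1/2) *\<^sub>R (X + Y \<cdot> Y) = Y"
    using sqrt_fixed_point[OF X s(2,3)] by blast
  define R where "R = (1 / sqrt s) *\<^sub>R (\<one> - Y)"
  have fix2: "X + Y \<cdot> Y = Y + Y" using arg_cong[OF fp, of "\<lambda>T. 2 *\<^sub>R T"] by (simp add: scaleR_2)
  have "(\<one> - Y) \<cdot> (\<one> - Y) = \<one> - X + (X + Y \<cdot> Y) - (Y + Y)" by (simp add: op_distribs)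
  also have "\<dots> = s *\<^sub>R a" by (simp only: fix2) (simp add: X_def)
  finally have sq: "(\<one> - Y) \<cdot> (\<one> - Y) = s *\<^sub>R a" .
  have RR: "R \<cdot> R = a"
    using s by (simp add: R_def op_distribs(7,8) sq)
  have "psd (\<one> - Y)"
  proof -
    have "cnj (cinner x (Y x)) = cinner x (Y x)" for x
      using Y(2) unfolding is_adjoint_def by (metis cinner_commute)
    then have "cinner x ((\<one> - Y) x) \<in> \<real>" for x
      by (simp add: blinfun.bilinear_simps cinner_diff_right cinner_self Reals_cnj_iff)
    moreover have "0 \<le> Re (cinner x ((\<one> - Y) x))" for x
    proof -
      have "Re (cinner x (Y x)) \<le> norm x * norm (Y x)"
        using cinner_Cauchy_Schwarz complex_Re_le_cmod order_trans by blast
      also have "\<dots> \<le> norm x * (norm Y * norm x)" by (intro mult_left_mono norm_blinfun) simp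
      also have "\<dots> \<le> norm x * (1 * norm x)"
        using Y(3) s by (intro mult_left_mono mult_right_mono) simp_all
      finally show ?thesis
        by (simp add: blinfun.bilinear_simps cinner_diff_right cinner_self power2_eq_square)
    qed
    ultimately show ?thesis unfolding psd_def using Y by (simp add: complex_linear_closure)
  qed
  then have "psd R" using s by (simp add: R_def psd_scaleR)
  moreover have "Z \<cdot> R = R \<cdot> Z" if "Z \<cdot> a = a \<cdot> Z" for Z
    using Ycomm[of Z] that by (simp add: X_def R_def op_distribs)
  ultimately show ?thesis using that RR by blast
qed

text \<open>Uniqueness. A second root \<open>Y\<close> commutes with \<open>a\<close>, hence with \<open>R\<close>, so that
  \<open>(R + Y) (R - Y) = 0\<close>; both summands are positive, so \<open>R\<close> annihilates the range of \<open>R - Y\<close>.\<close>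

lemma op_sqrt_eqI:
  fixes a :: "'h::chilbert_space op"
  assumes R: "psd R" "R \<cdot> R = a" and J: "J \<cdot> a = \<one>"
    and comm: "\<And>Z. Z \<cdot> a = a \<cdot> Z \<Longrightarrow> Z \<cdot> R = R \<cdot> Z"
  shows "op_sqrt a = R"
  unfolding op_sqrt_def
proof (rule the_equality)
  show "psd R \<and> R \<cdot> R = a" using R by simp
next
  fix Y assume Y: "psd Y \<and> Y \<cdot> Y = a"
  then have "Y \<cdot> R = R \<cdot> Y" using comm op_assoc by metis
  then have zero: "(R + Y) \<cdot> (R - Y) = 0" using R(2) Y by (simp add: op_distribs)
  have "R - Y = 0"
  proof (rule blinfun_eqI)
    fix x
    let ?z = "blinfun_apply (R - Y) x"
    have "blinfun_apply ((R + Y) \<cdot> (R - Y)) x = R ?z + Y ?z" by (simp add: blinfun.add_left)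
    then have "cinner ?z (R ?z) + cinner ?z (Y ?z) = 0"
      using zero by (simp add: cinner_add_right[symmetric])
    then have "Re (cinner ?z (R ?z)) + Re (cinner ?z (Y ?z)) = 0" by (metis plus_complex.sel(1) zero_complex.sel(1))
    moreover have "0 \<le> Re (cinner ?z (R ?z))" "0 \<le> Re (cinner ?z (Y ?z))"
      using R Y by (auto simp: psd_def)
    ultimately have "R ?z = 0" using psd_form_zero[OF R(1)] by auto
    then have "blinfun_apply (J \<cdot> (R \<cdot> R)) ?z = 0" by simp
    then show "?z = blinfun_apply 0 x" using R J by simp
  qed
  then show "Y = R" by simp
qed

section \<open>Von Neumann algebras, traces and homomorphisms\<close>

locale vn_alg =
  fixes M :: "'h::chilbert_space op set"
  assumes vn: "von_neumann_algebra M"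
begin

text \<open>The bicommutant property turns membership into a commutation test. This is how inverses and
  square roots are seen to stay in the algebra.\<close>

lemma memI:
  assumes "complex_linear X" "\<And>Z. complex_linear Z \<Longrightarrow> (\<And>Y. Y \<in> M \<Longrightarrow> Z \<cdot> Y = Y \<cdot> Z) \<Longrightarrow> Z \<cdot> X = X \<cdot> Z"
  shows "X \<in> M"
proof -
  have "X \<in> commutant (commutant M)"
    unfolding commutant_def using assms by (simp add: eq_commute)
  then show ?thesis using vn by (simp add: von_neumann_algebra_def)
qed

lemma mem_complex_linear: "X \<in> M \<Longrightarrow> complex_linear X"
  using vn by (simp add: von_neumann_algebra_def)

lemma one_mem: "\<one> \<in> M" and zero_mem: "0 \<in> M"
  by (rule memI; simp add: complex_linear_closure)+

lemma add_mem: "X \<in> M \<Longrightarrow> Y \<in> M \<Longrightarrow> X + Y \<in> M"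
  by (rule memI) (simp_all add: complex_linear_closure mem_complex_linear op_distribs)

lemma diff_mem: "X \<in> M \<Longrightarrow> Y \<in> M \<Longrightarrow> X - Y \<in> M"
  by (rule memI) (simp_all add: complex_linear_closure mem_complex_linear op_distribs)

lemma mult_mem:
  assumes "X \<in> M" "Y \<in> M"
  shows "X \<cdot> Y \<in> M"
proof (rule memI)
  show "complex_linear (X \<cdot> Y)" using assms by (simp add: complex_linear_closure mem_complex_linear)
  fix Z assume "\<And>W. W \<in> M \<Longrightarrow> Z \<cdot> W = W \<cdot> Z"
  then have "Z \<cdot> X = X \<cdot> Z" "Z \<cdot> Y = Y \<cdot> Z" using assms by blast+
  then show "Z \<cdot> (X \<cdot> Y) = X \<cdot> Y \<cdot> Z" by (metis op_assoc)
qed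

lemma scaleC_mem: "X \<in> M \<Longrightarrow> op_scaleC c X \<in> M"
  by (rule memI) (simp_all add: complex_linear_closure mem_complex_linear op_scaleC_left op_scaleC_right)

lemma scaleR_mem: "X \<in> M \<Longrightarrow> t *\<^sub>R X \<in> M"
  by (simp add: scaleR_eq_op_scaleC scaleC_mem)

lemma sum_mem: "(\<And>i. i \<in> I \<Longrightarrow> f i \<in> M) \<Longrightarrow> (\<Sum>i\<in>I. f i) \<in> M"
  by (induction I rule: infinite_finite_induct) (auto intro: zero_mem add_mem)

lemma is_adjoint_adj: "X \<in> M \<Longrightarrow> is_adjoint X (X\<^sup>\<dagger>)"
  using vn adj_eqI unfolding von_neumann_algebra_def by metis

lemma adj_mem: "X \<in> M \<Longrightarrow> X\<^sup>\<dagger> \<in> M"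
  using vn adj_eqI unfolding von_neumann_algebra_def by metis

lemmas mem = one_mem zero_mem add_mem diff_mem mult_mem scaleC_mem scaleR_mem adj_mem sum_mem

lemma adj_adj: "X \<in> M \<Longrightarrow> X\<^sup>\<dagger>\<^sup>\<dagger> = X"
  using is_adjoint_adj is_adjoint_commute adj_eqI by blast

lemma adj_mult: "X \<in> M \<Longrightarrow> Y \<in> M \<Longrightarrow> (X \<cdot> Y)\<^sup>\<dagger> = Y\<^sup>\<dagger> \<cdot> X\<^sup>\<dagger>"
  by (intro adj_eqI is_adjoint_compose is_adjoint_adj)

lemma adj_add: "X \<in> M \<Longrightarrow> Y \<in> M \<Longrightarrow> (X + Y)\<^sup>\<dagger> = X\<^sup>\<dagger> + Y\<^sup>\<dagger>"
  by (intro adj_eqI is_adjoint_add is_adjoint_adj)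

lemma adj_diff: "X \<in> M \<Longrightarrow> Y \<in> M \<Longrightarrow> (X - Y)\<^sup>\<dagger> = X\<^sup>\<dagger> - Y\<^sup>\<dagger>"
  by (intro adj_eqI is_adjoint_diff is_adjoint_adj)

lemma adj_scaleC: "X \<in> M \<Longrightarrow> (op_scaleC c X)\<^sup>\<dagger> = op_scaleC (cnj c) (X\<^sup>\<dagger>)"
  by (intro adj_eqI is_adjoint_scaleC is_adjoint_adj)

lemma adj_scaleR: "X \<in> M \<Longrightarrow> (t *\<^sub>R X)\<^sup>\<dagger> = t *\<^sub>R X\<^sup>\<dagger>"
  by (intro adj_eqI is_adjoint_scaleR is_adjoint_adj)

lemma adj_one: "\<one>\<^sup>\<dagger> = \<one>" and adj_zero: "0\<^sup>\<dagger> = 0"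
  by (simp_all add: adj_eqI is_adjoint_one is_adjoint_zero)

lemma adj_sum: "(\<And>i. i \<in> I \<Longrightarrow> f i \<in> M) \<Longrightarrow> (\<Sum>i\<in>I. f i)\<^sup>\<dagger> = (\<Sum>i\<in>I. (f i)\<^sup>\<dagger>)"
  by (induction I rule: infinite_finite_induct) (auto simp: adj_add adj_zero sum_mem)

lemma adj_psd: "psd X \<Longrightarrow> X\<^sup>\<dagger> = X"
  by (intro adj_eqI psd_selfadjoint)

lemma psd_adj_mult: "X \<in> M \<Longrightarrow> psd (X\<^sup>\<dagger> \<cdot> X)"
  by (intro psd_adjoint_mult is_adjoint_adj mem_complex_linear adj_mem)

lemma adj_mult_zero: "X \<in> M \<Longrightarrow> X\<^sup>\<dagger> \<cdot> X = 0 \<Longrightarrow> X = 0"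
  using adjoint_mult_zero is_adjoint_adj by blast

lemma inverse_mem:
  assumes "a \<in> M" "a \<cdot> J = \<one>" "J \<cdot> a = \<one>"
  shows "J \<in> M"
proof (rule memI)
  have "J (scaleC c x) = scaleC c (J x)" for c x
  proof -
    have "J (scaleC c x) = J (scaleC c (a (J x)))"
      using assms(2) by (metis blinfun_apply_blinfun_compose blinfun_apply_id_blinfun)
    also have "\<dots> = J (a (scaleC c (J x)))"
      using mem_complex_linear[OF assms(1)] by (simp add: complex_linear_def)
    also have "\<dots> = scaleC c (J x)"
      using assms(3) by (metis blinfun_apply_blinfun_compose blinfun_apply_id_blinfun)
    finally show ?thesis .
  qed
  then show "complex_linear J" by (simp add: complex_linear_def)
next
  fix Z assume "\<And>Y. Y \<in> M \<Longrightarrow> Z \<cdot> Y = Y \<cdot> Z"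
  then have "Z \<cdot> a = a \<cdot> Z" using assms(1) by blast
  then have "J \<cdot> (Z \<cdot> a) \<cdot> J = J \<cdot> (a \<cdot> Z) \<cdot> J" by simp
  then show "Z \<cdot> J = J \<cdot> Z" using assms(2,3) by (metis op_assoc op_one_left op_one_right)
qed

lemma strictly_positive_inverse:
  assumes "a \<in> M" "strictly_positive a"
  obtains J where "J \<in> M" "a \<cdot> J = \<one>" "J \<cdot> a = \<one>"
  using strictly_positive_invertible[OF assms(2)] inverse_mem[OF assms(1)] by metis

text \<open>The root commutes with everything that commutes with \<open>a\<close>, in particular with the commutant
  of \<open>M\<close>. A left inverse of the root is \<open>J R\<close>, where \<open>J\<close> inverts \<open>a\<close>.\<close>

lemma op_sqrt_properties:
  assumes "a \<in> M" "strictly_positive a"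
  shows "op_sqrt a \<in> M" "psd (op_sqrt a)" "op_sqrt a \<cdot> op_sqrt a = a"
    "strictly_positive (op_sqrt a)"
proof -
  obtain J where J: "J \<in> M" "a \<cdot> J = \<one>" "J \<cdot> a = \<one>" using strictly_positive_inverse[OF assms] .
  obtain R where R: "psd R" "R \<cdot> R = a" and comm: "\<And>Z. Z \<cdot> a = a \<cdot> Z \<Longrightarrow> Z \<cdot> R = R \<cdot> Z"
    using strictly_positive_sqrt_exists[OF assms(2)] by blast
  have eq: "op_sqrt a = R" by (rule op_sqrt_eqI[OF R J(3) comm])
  have "R \<in> M" using R(1) comm assms(1) by (intro memI) (auto simp: psd_def)
  then show "op_sqrt a \<in> M" "psd (op_sqrt a)" "op_sqrt a \<cdot> op_sqrt a = a"
    using eq R by simp_all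
  have "(J \<cdot> R) \<cdot> R = \<one>" using R J by (simp add: op_assoc)
  then show "strictly_positive (op_sqrt a)"
    unfolding eq using R(1) strictly_positive_if_left_inverse by blast
qed

text \<open>A self-adjoint \<open>a\<^sup>-\<^sup>1\<^sup>/\<^sup>2\<close>, the pivot of a Cholesky step.\<close>

lemma inverse_sqrt:
  assumes "a \<in> M" "strictly_positive a" and J: "a \<cdot> J = \<one>" "J \<cdot> a = \<one>"
  obtains c where "c \<in> M" "c\<^sup>\<dagger> = c" "c \<cdot> c = J"
proof -
  let ?R = "op_sqrt a"
  note R = op_sqrt_properties[OF assms(1,2)]
  have mem: "J \<in> M" by (rule inverse_mem[OF assms(1) J])
  have "?R \<cdot> a = a \<cdot> ?R" using R(3) op_assoc by metis
  then have "J \<cdot> (?R \<cdot> a) \<cdot> J = J \<cdot> (a \<cdot> ?R) \<cdot> J" by simp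
  then have comm: "J \<cdot> ?R = ?R \<cdot> J" using J by (metis op_assoc op_one_left op_one_right)
  have "J\<^sup>\<dagger> \<cdot> a = \<one>"
    using arg_cong[OF J(1), of adj] assms(1,2) mem
    by (simp add: adj_mult adj_one adj_psd strictly_positive_def)
  then have Jadj: "J\<^sup>\<dagger> = J" using J(1) by (metis op_assoc op_one_left op_one_right)
  show ?thesis
  proof (rule that[of "J \<cdot> ?R"])
    show "J \<cdot> ?R \<in> M" using mem R by (simp add: mult_mem)
    show "(J \<cdot> ?R)\<^sup>\<dagger> = J \<cdot> ?R" using mem R comm Jadj by (simp add: adj_mult adj_psd)
    have "J \<cdot> ?R \<cdot> (J \<cdot> ?R) = J \<cdot> (J \<cdot> (?R \<cdot> ?R))" using comm op_assoc by metis
    then show "J \<cdot> ?R \<cdot> (J \<cdot> ?R) = J" using R J by simp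
  qed
qed

end

lemma vn_alg_if_fd: "fd_von_neumann_algebra M \<Longrightarrow> vn_alg M"
  by (simp add: fd_von_neumann_algebra_def vn_alg_def)

locale traced_vn_alg = vn_alg M for M :: "'h::chilbert_space op set" +
  fixes \<tau> :: "'h op \<Rightarrow> complex"
  assumes ft: "faithful_tracial_functional M \<tau>"
begin

lemma trace_add: "X \<in> M \<Longrightarrow> Y \<in> M \<Longrightarrow> \<tau> (X + Y) = \<tau> X + \<tau> Y"
  using ft by (simp add: faithful_tracial_functional_def)

lemma trace_scaleC: "X \<in> M \<Longrightarrow> \<tau> (op_scaleC c X) = c * \<tau> X"
  using ft by (simp add: faithful_tracial_functional_def)

lemma trace_scaleR: "X \<in> M \<Longrightarrow> \<tau> (t *\<^sub>R X) = complex_of_real t * \<tau> X"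
  by (simp add: scaleR_eq_op_scaleC trace_scaleC)

lemma trace_zero: "\<tau> 0 = 0"
  using trace_scaleR[OF zero_mem, of 0] by simp

lemma trace_diff: "X \<in> M \<Longrightarrow> Y \<in> M \<Longrightarrow> \<tau> (X - Y) = \<tau> X - \<tau> Y"
  using trace_add[of X "(-1) *\<^sub>R Y"] trace_scaleR[of Y "-1"] scaleR_mem[of Y "-1"] by simp

lemma trace_sum: "(\<And>i. i \<in> I \<Longrightarrow> f i \<in> M) \<Longrightarrow> \<tau> (\<Sum>i\<in>I. f i) = (\<Sum>i\<in>I. \<tau> (f i))"
  by (induction I rule: infinite_finite_induct) (auto simp: trace_add trace_zero sum_mem)

lemma trace_cyclic: "X \<in> M \<Longrightarrow> Y \<in> M \<Longrightarrow> \<tau> (X \<cdot> Y) = \<tau> (Y \<cdot> X)"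
  using ft by (simp add: faithful_tracial_functional_def)

lemma trace_psd: "X \<in> M \<Longrightarrow> psd X \<Longrightarrow> \<tau> X \<in> \<real> \<and> 0 \<le> Re (\<tau> X)"
  using ft by (simp add: faithful_tracial_functional_def)

lemma trace_faithful: "X \<in> M \<Longrightarrow> psd X \<Longrightarrow> \<tau> X = 0 \<Longrightarrow> X = 0"
  using ft by (simp add: faithful_tracial_functional_def)

lemma trace_square: "X \<in> M \<Longrightarrow> \<tau> (X\<^sup>\<dagger> \<cdot> X) \<in> \<real> \<and> 0 \<le> Re (\<tau> (X\<^sup>\<dagger> \<cdot> X))"
  by (intro trace_psd psd_adj_mult mult_mem adj_mem)

lemma trace_square_zero: "X \<in> M \<Longrightarrow> Re (\<tau> (X\<^sup>\<dagger> \<cdot> X)) \<le> 0 \<Longrightarrow> X = 0"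
proof (rule adj_mult_zero)
  assume X: "X \<in> M" "Re (\<tau> (X\<^sup>\<dagger> \<cdot> X)) \<le> 0"
  then have "\<tau> (X\<^sup>\<dagger> \<cdot> X) = 0"
    using trace_square[of X] by (simp add: complex_is_Real_iff complex_eq_iff)
  then show "X\<^sup>\<dagger> \<cdot> X = 0"
    using X by (intro trace_faithful psd_adj_mult mult_mem adj_mem)
qed

text \<open>A self-adjoint \<open>X\<close> is the difference of the positive operators \<open>X + \<parallel>X\<parallel> \<one>\<close> and
  \<open>\<parallel>X\<parallel> \<one>\<close>, so a positive functional is real on it.\<close>

lemma trace_selfadjoint_real:
  assumes "X \<in> M" "X\<^sup>\<dagger> = X"
  shows "\<tau> X \<in> \<real>"
proof -
  define Y where "Y = X + norm X *\<^sub>R \<one>"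
  have adj: "is_adjoint X X" using is_adjoint_adj assms by metis
  have form: "cinner x (Y x) = cinner x (X x) + complex_of_real (norm X * (norm x)\<^sup>2)" for x
    by (simp add: Y_def blinfun.bilinear_simps cinner_add_right cinner_scaleR_right cinner_self)
  have "cnj (cinner x (X x)) = cinner x (X x)" for x
    using adj unfolding is_adjoint_def by (metis cinner_commute)
  then have "cinner x (Y x) \<in> \<real>" for x
    unfolding form by (simp add: Reals_cnj_iff)
  moreover have "0 \<le> Re (cinner x (Y x))" for x
  proof -
    have "- Re (cinner x (X x)) \<le> norm x * norm (X x)"
      using cinner_Cauchy_Schwarz[of x "X x"] abs_Re_le_cmod[of "cinner x (X x)"] by linarith
    also have "\<dots> \<le> norm x * (norm X * norm x)" by (intro mult_left_mono norm_blinfun) simp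
    finally show ?thesis unfolding form by (simp add: power2_eq_square algebra_simps)
  qed
  ultimately have "psd Y"
    using assms by (simp add: psd_def Y_def complex_linear_closure mem_complex_linear)
  moreover have "Y \<in> M" using assms by (simp add: Y_def mem)
  ultimately have "\<tau> Y \<in> \<real>" using trace_psd by blast
  moreover have "\<tau> Y = \<tau> X + complex_of_real (norm X) * \<tau> \<one>"
    using assms by (simp add: Y_def trace_add trace_scaleR mem)
  moreover have "\<tau> \<one> \<in> \<real>" using trace_psd[OF one_mem psd_one] by blast
  ultimately show ?thesis by (metis Reals_diff Reals_mult Reals_of_real add_diff_cancel_right')
qed

text \<open>The trace is real on the self-adjoint elements \<open>X + X\<^sup>\<dagger>\<close> and \<open>\<i> (X - X\<^sup>\<dagger>)\<close>, which is the input
  of polarization.\<close>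

lemma trace_adj:
  assumes "X \<in> M"
  shows "\<tau> (X\<^sup>\<dagger>) = cnj (\<tau> X)"
proof -
  have "\<tau> (X + X\<^sup>\<dagger>) \<in> \<real>"
    using assms by (intro trace_selfadjoint_real) (simp_all add: mem adj_add adj_adj add.commute)
  then have 1: "\<tau> X + \<tau> (X\<^sup>\<dagger>) \<in> \<real>" using assms by (simp add: trace_add mem)
  have neg: "op_scaleC (- c) Y = - op_scaleC c Y" for c and Y :: "'h op"
  proof (rule blinfun_eqI)
    fix x
    have "scaleC (- c) y + scaleC c y = scaleC 0 y" for y :: 'h
      by (simp add: scaleC_add_left[symmetric])
    moreover have "scaleC 0 y = 0" for y :: 'h
      using scaleC_of_real[of 0 y] by simp
    ultimately show "blinfun_apply (op_scaleC (- c) Y) x = blinfun_apply (- op_scaleC c Y) x"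
      by (simp add: blinfun.minus_left eq_neg_iff_add_eq_0)
  qed
  have "\<tau> (op_scaleC \<i> X - op_scaleC \<i> (X\<^sup>\<dagger>)) \<in> \<real>"
    using assms
    by (intro trace_selfadjoint_real) (simp_all add: mem adj_diff adj_scaleC adj_adj neg)
  then have 2: "\<i> * \<tau> X - \<i> * \<tau> (X\<^sup>\<dagger>) \<in> \<real>"
    using assms by (simp add: trace_diff trace_scaleC mem)
  have "\<tau> X = cnj (\<tau> (X\<^sup>\<dagger>))" by (rule cnj_swap_if_real_quadratic[OF 1 2])
  then show ?thesis by simp
qed

text \<open>With \<open>D = s V - k V t\<close> one has \<open>s D + k D t = 0\<close>. Multiplying by \<open>D\<^sup>\<dagger>\<close> and taking the trace
  gives two non-negative numbers with sum \<open>0\<close>, and faithfulness yields \<open>D = 0\<close>.\<close>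

lemma sqrt_intertwines:
  assumes s: "s \<in> M" "strictly_positive s" and t: "t \<in> M" "strictly_positive t"
    and V: "V \<in> M" and k: "0 < k" and eq: "s \<cdot> s \<cdot> V = (k * k) *\<^sub>R (V \<cdot> t \<cdot> t)"
  shows "s \<cdot> V = k *\<^sub>R (V \<cdot> t)"
proof -
  define D where "D = s \<cdot> V - k *\<^sub>R (V \<cdot> t)"
  let ?p = "op_sqrt s" and ?q = "op_sqrt t"
  note p = op_sqrt_properties[OF s] and q = op_sqrt_properties[OF t]
  have D: "D \<in> M" using s t V by (simp add: D_def mem)
  have "s \<cdot> D + k *\<^sub>R (D \<cdot> t) = 0"
    using eq by (simp add: D_def op_distribs op_assoc scaleR_diff_right)
  then have "\<tau> (D\<^sup>\<dagger> \<cdot> (s \<cdot> D + k *\<^sub>R (D \<cdot> t))) = 0" by (simp add: trace_zero)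
  then have sum: "\<tau> (D\<^sup>\<dagger> \<cdot> (s \<cdot> D)) + k * \<tau> (D\<^sup>\<dagger> \<cdot> (D \<cdot> t)) = 0"
    using s t D by (simp add: op_distribs trace_add trace_scaleR mem)
  have "(?p \<cdot> D)\<^sup>\<dagger> \<cdot> (?p \<cdot> D) = D\<^sup>\<dagger> \<cdot> (?p \<cdot> ?p \<cdot> D)"
    by (simp only: adj_mult[OF p(1) D] adj_psd[OF p(2)] op_assoc)
  then have 1: "\<tau> (D\<^sup>\<dagger> \<cdot> (s \<cdot> D)) = \<tau> ((?p \<cdot> D)\<^sup>\<dagger> \<cdot> (?p \<cdot> D))" using p by simp
  have "\<tau> ((D \<cdot> ?q)\<^sup>\<dagger> \<cdot> (D \<cdot> ?q)) = \<tau> (?q \<cdot> (D\<^sup>\<dagger> \<cdot> D \<cdot> ?q))"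
    by (simp only: adj_mult[OF D q(1)] adj_psd[OF q(2)] op_assoc)
  also have "\<dots> = \<tau> (D\<^sup>\<dagger> \<cdot> D \<cdot> ?q \<cdot> ?q)" using q D by (intro trace_cyclic) (simp_all add: mem)
  finally have 2: "\<tau> (D\<^sup>\<dagger> \<cdot> (D \<cdot> t)) = \<tau> ((D \<cdot> ?q)\<^sup>\<dagger> \<cdot> (D \<cdot> ?q))" using q by (simp add: op_assoc)
  have "0 \<le> k * Re (\<tau> ((D \<cdot> ?q)\<^sup>\<dagger> \<cdot> (D \<cdot> ?q)))"
    using trace_square[of "D \<cdot> ?q"] k q D by (simp add: mem)
  moreover have "Re (\<tau> ((?p \<cdot> D)\<^sup>\<dagger> \<cdot> (?p \<cdot> D))) + k * Re (\<tau> ((D \<cdot> ?q)\<^sup>\<dagger> \<cdot> (D \<cdot> ?q))) = 0"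
    using arg_cong[OF sum, of Re] unfolding 1 2 by simp
  ultimately have "Re (\<tau> ((?p \<cdot> D)\<^sup>\<dagger> \<cdot> (?p \<cdot> D))) \<le> 0" by linarith
  then have pD: "?p \<cdot> D = 0" using p D by (intro trace_square_zero) (simp_all add: mem)
  obtain J where "J \<cdot> ?p = \<one>" using strictly_positive_invertible[OF p(4)] .
  then have "D = 0" using pD op_assoc by (metis blinfun_compose_zero(2) op_one_left)
  then show ?thesis by (simp add: D_def)
qed

end

locale vn_hom = dom: vn_alg A + cod: vn_alg B
  for A :: "'h::chilbert_space op set" and B :: "'k::chilbert_space op set" +
  fixes f :: "'h op \<Rightarrow> 'k op"
  assumes hom: "unital_star_hom A B f"
begin

lemma map_mem: "X \<in> A \<Longrightarrow> f X \<in> B"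
  and map_add: "X \<in> A \<Longrightarrow> Y \<in> A \<Longrightarrow> f (X + Y) = f X + f Y"
  and map_scaleC: "X \<in> A \<Longrightarrow> f (op_scaleC c X) = op_scaleC c (f X)"
  and map_mult: "X \<in> A \<Longrightarrow> Y \<in> A \<Longrightarrow> f (X \<cdot> Y) = f X \<cdot> f Y"
  and map_adj: "X \<in> A \<Longrightarrow> f (X\<^sup>\<dagger>) = (f X)\<^sup>\<dagger>"
  and map_one: "f \<one> = \<one>"
  using hom by (simp_all add: unital_star_hom_def)

lemma map_scaleR: "X \<in> A \<Longrightarrow> f (t *\<^sub>R X) = t *\<^sub>R f X"
  by (simp add: scaleR_eq_op_scaleC map_scaleC)

lemma map_zero: "f 0 = 0"
  using map_scaleR[OF dom.zero_mem, of 0] by simp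

text \<open>Homomorphisms preserve squares of self-adjoint elements and left inverses, and these two
  properties characterize strict positivity.\<close>

lemma map_strictly_positive:
  assumes "X \<in> A" "strictly_positive X"
  shows "strictly_positive (f X)"
proof -
  note R = dom.op_sqrt_properties[OF assms]
  obtain J where J: "J \<in> A" "J \<cdot> X = \<one>" using dom.strictly_positive_inverse[OF assms] .
  have "f X = (f (op_sqrt X))\<^sup>\<dagger> \<cdot> f (op_sqrt X)"
    using R by (simp add: map_adj[symmetric] map_mult[symmetric] dom.adj_psd)
  then have "psd (f X)" using R by (simp add: cod.psd_adj_mult map_mem)
  moreover have "f J \<cdot> f X = \<one>" using J assms by (simp add: map_mult[symmetric] map_one)
  ultimately show ?thesis by (rule strictly_positive_if_left_inverse)
qed

end


section \<open>Positive matrices over a von Neumann algebra\<close>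

definition matrix_form :: "nat \<Rightarrow> (nat \<Rightarrow> nat \<Rightarrow> 'h::chilbert_space op) \<Rightarrow> (nat \<Rightarrow> 'h) \<Rightarrow> complex" where
  "matrix_form m F v = (\<Sum>i<m. cinner (v i) (\<Sum>j<m. blinfun_apply (F i j) (v j)))"

text \<open>At \<open>\<epsilon> = 0\<close> this is positivity. A positive \<open>\<epsilon>\<close> makes the diagonal entries invertible, and the
  same \<open>\<epsilon>\<close> works for all Schur complements.\<close>

definition matrix_bounded_below :: "nat \<Rightarrow> real \<Rightarrow> (nat \<Rightarrow> nat \<Rightarrow> 'h::chilbert_space op) \<Rightarrow> bool" where
  "matrix_bounded_below m \<epsilon> F \<longleftrightarrow> (\<forall>v. matrix_form m F v \<in> \<real> \<and>
     \<epsilon> * (\<Sum>i<m. (norm (v i))\<^sup>2) \<le> Re (matrix_form m F v))"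

lemma matrices_psd_iff:
  "F \<in> matrices_psd m M \<longleftrightarrow> F \<in> matrices_over m M \<and> matrix_bounded_below m 0 F"
  by (simp add: matrices_psd_def matrix_bounded_below_def matrix_form_def)

lemma sum_two_supported:
  fixes f :: "nat \<Rightarrow> 'b::comm_monoid_add"
  assumes "i < m" "j < m" "i \<noteq> j" "\<And>k. k < m \<Longrightarrow> k \<noteq> i \<Longrightarrow> k \<noteq> j \<Longrightarrow> f k = 0"
  shows "(\<Sum>k<m. f k) = f i + f j"
proof -
  have "(\<Sum>k<m. f k) = (\<Sum>k\<in>{i, j}. f k)"
    using assms by (intro sum.mono_neutral_right) auto
  then show ?thesis using assms(3) by simp
qed

lemma matrix_form_single:
  assumes "i < m"
  shows "matrix_form m F (\<lambda>k. if k = i then x else 0) = cinner x (F i i x)"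
  using assms unfolding matrix_form_def
  by (simp add: if_distrib[of "\<lambda>z. cinner z _"] if_distrib[of "blinfun_apply _"] blinfun.zero_right cong: if_cong)

lemma matrix_form_pair:
  assumes "i < m" "j < m" "i \<noteq> j"
  shows "matrix_form m F (\<lambda>k. if k = i then x else if k = j then y else 0) =
    cinner x (F i i x) + cinner x (F i j y) + cinner y (F j i x) + cinner y (F j j y)"
  using assms unfolding matrix_form_def
  by (simp add: sum_two_supported[OF assms] blinfun.zero_right cinner_add_right)

text \<open>Polarization with vectors supported on the coordinates \<open>i\<close> and \<open>j\<close>.\<close>

lemma matrix_real_form_adjoint:
  assumes real: "\<And>v. matrix_form m F v \<in> \<real>" and ij: "i < m" "j < m"
    and lin: "complex_linear (F i j)" "complex_linear (F j i)"
  shows "is_adjoint (F j i) (F i j)"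
proof (cases "i = j")
  case True
  have "cinner x (F i i x) \<in> \<real>" for x
    using real matrix_form_single[OF ij(1), of F x] by metis
  then show ?thesis using True lin by (simp add: real_form_selfadjoint)
next
  case False
  have diag: "cinner x (F k k x) \<in> \<real>" if "k < m" for k x
    using real matrix_form_single[OF that, of F x] by metis
  have off: "cinner x (F i j y) + cinner y (F j i x) \<in> \<real>" for x y
  proof -
    have "cinner x (F i j y) + cinner y (F j i x) =
      matrix_form m F (\<lambda>k. if k = i then x else if k = j then y else 0)
        - cinner x (F i i x) - cinner y (F j j y)"
      by (simp add: matrix_form_pair[OF ij False])
    then show ?thesis using real diag ij by simp
  qed
  show ?thesis
    unfolding is_adjoint_def
  proof (intro allI)
    fix x y
    have "\<i> * cinner x (F i j y) - \<i> * cinner y (F j i x) \<in> \<real>"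
      using off[of x "scaleC \<i> y"] lin
      by (simp add: complex_linear_def cinner_scaleC_left cinner_scaleC_right)
    from cnj_swap_if_real_quadratic[OF off this] show "cinner (F j i x) y = cinner x (F i j y)"
      by (metis cinner_commute)
  qed
qed


text \<open>Completing the square in the last coordinate: at \<open>v\<^sub>m = - J (\<Sum>j<m. F m j v\<^sub>j)\<close>, where \<open>J\<close>
  inverts the corner \<open>F m m\<close>, the form of \<open>F\<close> equals the form of the Schur complement.\<close>

lemma matrix_form_schur:
  assumes "F m m \<cdot> J = \<one>"
  shows "matrix_form m (\<lambda>i j. F i j - F i m \<cdot> J \<cdot> F m j) v =
    matrix_form (Suc m) F (v(m := - J (\<Sum>j<m. F m j (v j))))"
proof -
  define y where "y = (\<Sum>j<m. F m j (v j))"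
  define w where "w = v(m := - J y)"
  have aJ: "F m m (J z) = z" for z
    using assms by (metis blinfun_apply_blinfun_compose blinfun_apply_id_blinfun)
  have "(\<Sum>j<Suc m. F m j (w j)) = y + F m m (- J y)"
    by (simp add: w_def y_def)
  then have last: "(\<Sum>j<Suc m. F m j (w j)) = 0" by (simp add: blinfun.minus_right aJ)
  have row: "(\<Sum>j<Suc m. F i j (w j)) = (\<Sum>j<m. (F i j - F i m \<cdot> J \<cdot> F m j) (v j))" for i
  proof -
    have "(\<Sum>j<Suc m. F i j (w j)) = (\<Sum>j<m. F i j (v j)) - F i m (J y)"
      by (simp add: w_def blinfun.minus_right)
    also have "\<dots> = (\<Sum>j<m. (F i j - F i m \<cdot> J \<cdot> F m j) (v j))"
      by (simp add: y_def blinfun.diff_left sum_subtractf blinfun.sum_right)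
    finally show ?thesis .
  qed
  have "matrix_form (Suc m) F w =
      (\<Sum>i<m. cinner (w i) (\<Sum>j<Suc m. F i j (w j))) + cinner (w m) (\<Sum>j<Suc m. F m j (w j))"
    unfolding matrix_form_def by (rule sum.lessThan_Suc)
  also have "\<dots> = matrix_form m (\<lambda>i j. F i j - F i m \<cdot> J \<cdot> F m j) v"
    unfolding last row matrix_form_def by (simp add: w_def)
  finally show ?thesis by (simp add: w_def y_def)
qed

context vn_alg
begin

text \<open>Block Cholesky decomposition. Eliminating the last coordinate leaves the Schur complement,
  whose form is a restriction of the original one and hence bounded below by the same \<open>\<epsilon>\<close>; the
  eliminated part is \<open>(c F\<^sub>m\<^sub>i)\<^sup>\<dagger> (c F\<^sub>m\<^sub>j)\<close>, where \<open>c\<^sup>2\<close> is the inverse of the corner.\<close>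

lemma cholesky:
  assumes "0 < \<epsilon>" "\<And>i j. i < m \<Longrightarrow> j < m \<Longrightarrow> F i j \<in> M" "matrix_bounded_below m \<epsilon> F"
  shows "\<exists>z. (\<forall>k<m. \<forall>i<m. z k i \<in> M) \<and>
    (\<forall>i<m. \<forall>j<m. F i j = (\<Sum>k<m. (z k i)\<^sup>\<dagger> \<cdot> z k j))"
  using assms(2,3)
proof (induction m arbitrary: F)
  case 0
  then show ?case by simp
next
  case (Suc m)
  note memF = Suc.prems(1)
  have real: "matrix_form (Suc m) F v \<in> \<real>"
    and below: "\<epsilon> * (\<Sum>i<Suc m. (norm (v i))\<^sup>2) \<le> Re (matrix_form (Suc m) F v)" for v
    using Suc.prems(2) unfolding matrix_bounded_below_def by blast+
  have adjF: "(F j i)\<^sup>\<dagger> = F i j" if "i < Suc m" "j < Suc m" for i j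
    using that memF by (intro adj_eqI matrix_real_form_adjoint[OF real that] mem_complex_linear)
  let ?a = "F m m"
  have a: "?a \<in> M" using memF by simp
  have single: "matrix_form (Suc m) F (\<lambda>k. if k = m then x else 0) = cinner x (?a x)" for x
    by (rule matrix_form_single) simp
  have "cinner x (?a x) \<in> \<real>" for x using real single by metis
  moreover have a_below: "\<epsilon> * (norm x)\<^sup>2 \<le> Re (cinner x (?a x))" for x
    using below[of "\<lambda>k. if k = m then x else 0"] unfolding single
    by simp
  moreover have "0 \<le> Re (cinner x (?a x))" for x
    using a_below[of x] assms(1) by (meson mult_nonneg_nonneg less_imp_le order_trans zero_le_power2)
  ultimately have sp: "strictly_positive ?a"
    unfolding strictly_positive_def psd_def using a assms(1) mem_complex_linear by blast
  obtain J where J: "J \<in> M" "?a \<cdot> J = \<one>" "J \<cdot> ?a = \<one>"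
    using strictly_positive_inverse[OF a sp] by blast
  obtain c where c: "c \<in> M" "c\<^sup>\<dagger> = c" "c \<cdot> c = J"
    using inverse_sqrt[OF a sp J(2,3)] by blast
  define G where "G i j = F i j - F i m \<cdot> J \<cdot> F m j" for i j
  have G_below: "matrix_bounded_below m \<epsilon> G"
    unfolding matrix_bounded_below_def
  proof
    fix v :: "nat \<Rightarrow> 'h"
    define w where "w = v(m := - J (\<Sum>j<m. F m j (v j)))"
    have eq: "matrix_form m G v = matrix_form (Suc m) F w"
      unfolding G_def w_def by (rule matrix_form_schur) (rule J(2))
    have "(\<Sum>i<m. (norm (v i))\<^sup>2) \<le> (\<Sum>i<Suc m. (norm (w i))\<^sup>2)" by (simp add: w_def)
    then have "\<epsilon> * (\<Sum>i<m. (norm (v i))\<^sup>2) \<le> \<epsilon> * (\<Sum>i<Suc m. (norm (w i))\<^sup>2)"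
      using assms(1) by (intro mult_left_mono) auto
    also have "\<dots> \<le> Re (matrix_form m G v)" unfolding eq by (rule below)
    finally have "\<epsilon> * (\<Sum>i<m. (norm (v i))\<^sup>2) \<le> Re (matrix_form m G v)" .
    moreover have "matrix_form m G v \<in> \<real>" unfolding eq by (rule real)
    ultimately show "matrix_form m G v \<in> \<real> \<and> \<epsilon> * (\<Sum>i<m. (norm (v i))\<^sup>2) \<le> Re (matrix_form m G v)"
      by (rule conjI[rotated])
  qed
  have G_mem: "G i j \<in> M" if "i < m" "j < m" for i j
    using that memF J by (simp add: G_def mem)
  have "\<exists>z. (\<forall>k<m. \<forall>i<m. z k i \<in> M) \<and>
      (\<forall>i<m. \<forall>j<m. G i j = (\<Sum>k<m. (z k i)\<^sup>\<dagger> \<cdot> z k j))"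
    by (rule Suc.IH[OF G_mem G_below])
  then obtain z where z: "\<forall>k<m. \<forall>i<m. z k i \<in> M"
    and G: "\<forall>i<m. \<forall>j<m. G i j = (\<Sum>k<m. (z k i)\<^sup>\<dagger> \<cdot> z k j)"
    by (elim exE conjE)
  define y where "y k j = (if k = m then c \<cdot> F m j else if j = m then 0 else z k j)" for k j
  have y_mem: "y k i \<in> M" if "k < Suc m" "i < Suc m" for k i
    using that z c memF by (auto simp: y_def mem less_Suc_eq)
  have F_eq: "F i j = (\<Sum>k<Suc m. (y k i)\<^sup>\<dagger> \<cdot> y k j)" if ij: "i < Suc m" "j < Suc m" for i j
  proof -
    have "(c \<cdot> F m i)\<^sup>\<dagger> \<cdot> (c \<cdot> F m j) = F i m \<cdot> (c \<cdot> c) \<cdot> F m j"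
      using ij c(1,2) memF by (simp add: adj_mult adjF op_assoc)
    then have last: "(y m i)\<^sup>\<dagger> \<cdot> y m j = F i m \<cdot> J \<cdot> F m j" by (simp add: y_def c)
    have sum: "(\<Sum>k<Suc m. (y k i)\<^sup>\<dagger> \<cdot> y k j) = (\<Sum>k<m. (y k i)\<^sup>\<dagger> \<cdot> y k j) + F i m \<cdot> J \<cdot> F m j"
      using last by simp
    show ?thesis
    proof (cases "i = m \<or> j = m")
      case True
      then have "(\<Sum>k<m. (y k i)\<^sup>\<dagger> \<cdot> y k j) = 0"
        by (intro sum.neutral) (auto simp: y_def adj_zero)
      moreover have "F m m \<cdot> J \<cdot> F m j = F m j" using J(2) by simp
      moreover have "F i m \<cdot> J \<cdot> F m m = F i m" using J(3) by (simp add: op_assoc)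
      ultimately show ?thesis using sum True by auto
    next
      case False
      then have "(\<Sum>k<m. (y k i)\<^sup>\<dagger> \<cdot> y k j) = G i j"
        using ij by (simp add: G y_def)
      then show ?thesis using sum by (simp add: G_def)
    qed
  qed
  show ?case by (intro exI[of _ y] conjI allI impI y_mem F_eq)
qed

end

section \<open>Positive matrices paired through two homomorphisms\<close>

lemma nonneg_if_perturbation_nonneg:
  fixes a b c :: real
  assumes "\<And>\<epsilon>. 0 < \<epsilon> \<Longrightarrow> 0 \<le> a + \<epsilon> * b + \<epsilon>\<^sup>2 * c"
  shows "0 \<le> a"
proof (rule tendsto_lowerbound)
  show "((\<lambda>\<epsilon>. a + \<epsilon> * b + \<epsilon>\<^sup>2 * c) \<longlongrightarrow> a) (at_right 0)"
    by (auto intro!: tendsto_eq_intros)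
  show "\<forall>\<^sub>F \<epsilon> in at_right 0. 0 \<le> a + \<epsilon> * b + \<epsilon>\<^sup>2 * c"
    using assms eventually_at_right_less[of "0::real"] by (auto elim: eventually_mono)
qed simp

lemma linear_coefficient_zero:
  fixes b c :: real
  assumes "\<And>t. 0 \<le> t * b + t\<^sup>2 * c"
  shows "b = 0"
proof -
  have "0 \<le> s * b" if "s = 1 \<or> s = -1" for s
  proof (rule nonneg_if_perturbation_nonneg[of _ c 0])
    fix \<epsilon> :: real assume "0 < \<epsilon>"
    then have "0 \<le> \<epsilon> * (s * b + \<epsilon> * c)"
      using assms[of "\<epsilon> * s"] that by (auto simp: power2_eq_square algebra_simps)
    then show "0 \<le> s * b + \<epsilon> * c + \<epsilon>\<^sup>2 * 0" using \<open>0 < \<epsilon>\<close> by (simp add: zero_le_mult_iff)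
  qed
  from this[of 1] this[of "-1"] show ?thesis by simp
qed

lemma matrix_bounded_below_shift:
  assumes "matrix_bounded_below m 0 F"
  shows "matrix_bounded_below m \<epsilon> (\<lambda>i j. F i j + (if i = j then \<epsilon> else 0) *\<^sub>R \<one>)"
    (is "matrix_bounded_below m \<epsilon> ?F")
proof -
  have "matrix_form m ?F v = matrix_form m F v + complex_of_real (\<epsilon> * (\<Sum>i<m. (norm (v i))\<^sup>2))" for v
  proof -
    have "(\<Sum>j<m. ?F i j (v j)) = (\<Sum>j<m. F i j (v j)) + \<epsilon> *\<^sub>R v i" if "i < m" for i
    proof -
      have "?F i j (v j) = F i j (v j) + (if i = j then \<epsilon> *\<^sub>R v i else 0)" for j
        by (simp add: blinfun.bilinear_simps)
      then show ?thesis using that by (simp add: sum.distrib)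
    qed
    then show ?thesis
      by (simp add: matrix_form_def cinner_add_right cinner_scaleR_right cinner_self sum.distrib
          sum_distrib_left)
  qed
  then show ?thesis using assms by (simp add: matrix_bounded_below_def)
qed

locale traced_hom_pair = dom: vn_alg A + cod: traced_vn_alg B \<tau> + l: vn_hom A B l + r: vn_hom A B r
  for A :: "'h::chilbert_space op set" and B :: "'k::chilbert_space op set" and \<tau>
    and l r :: "'h op \<Rightarrow> 'k op"
begin

text \<open>The correlation form of the pair. It is the common language of the conjugacy hypothesis, of
  the expanded energy and, for \<open>l = r = id\<close> and \<open>W = S\<close>, of the KMS inner product.\<close>

definition corr :: "'k op \<Rightarrow> 'h op \<Rightarrow> 'h op \<Rightarrow> complex" where
  "corr W X Y = \<tau> (W\<^sup>\<dagger> \<cdot> l X \<cdot> W \<cdot> r Y)"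

lemma corr_add_left: "W \<in> B \<Longrightarrow> X \<in> A \<Longrightarrow> X' \<in> A \<Longrightarrow> Y \<in> A \<Longrightarrow> corr W (X + X') Y = corr W X Y + corr W X' Y"
  and corr_add_right: "W \<in> B \<Longrightarrow> X \<in> A \<Longrightarrow> Y' \<in> A \<Longrightarrow> Y \<in> A \<Longrightarrow> corr W X (Y + Y') = corr W X Y + corr W X Y'"
  and corr_scaleR_left: "W \<in> B \<Longrightarrow> X \<in> A \<Longrightarrow> Y \<in> A \<Longrightarrow> corr W (t *\<^sub>R X) Y = complex_of_real t * corr W X Y"
  and corr_scaleR_right: "W \<in> B \<Longrightarrow> X \<in> A \<Longrightarrow> Y \<in> A \<Longrightarrow> corr W X (t *\<^sub>R Y) = complex_of_real t * corr W X Y"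
  by (simp_all add: corr_def l.map_add r.map_add l.map_scaleR r.map_scaleR op_distribs
      cod.trace_add cod.trace_scaleR cod.mem l.map_mem r.map_mem)

lemma corr_zero: "corr W 0 Y = 0" "corr W X 0 = 0"
  by (simp_all add: corr_def l.map_zero r.map_zero cod.trace_zero)

lemma corr_sum_left: "W \<in> B \<Longrightarrow> (\<And>i. i \<in> I \<Longrightarrow> f i \<in> A) \<Longrightarrow> Y \<in> A \<Longrightarrow>
    corr W (\<Sum>i\<in>I. f i) Y = (\<Sum>i\<in>I. corr W (f i) Y)"
  by (induction I rule: infinite_finite_induct) (auto simp: corr_add_left corr_zero dom.sum_mem)

lemma corr_sum_right: "W \<in> B \<Longrightarrow> (\<And>i. i \<in> I \<Longrightarrow> f i \<in> A) \<Longrightarrow> X \<in> A \<Longrightarrow>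
    corr W X (\<Sum>i\<in>I. f i) = (\<Sum>i\<in>I. corr W X (f i))"
  by (induction I rule: infinite_finite_induct) (auto simp: corr_add_right corr_zero dom.sum_mem)

lemma corr_adj:
  assumes "W \<in> B" "X \<in> A" "Y \<in> A"
  shows "corr W (X\<^sup>\<dagger>) (Y\<^sup>\<dagger>) = cnj (corr W X Y)"
proof -
  note m = assms l.map_mem[OF assms(2)] r.map_mem[OF assms(3)]
  have "cnj (corr W X Y) = \<tau> ((W\<^sup>\<dagger> \<cdot> l X \<cdot> W \<cdot> r Y)\<^sup>\<dagger>)"
    using m by (simp add: corr_def cod.trace_adj cod.mem)
  also have "\<dots> = \<tau> ((r Y)\<^sup>\<dagger> \<cdot> (W\<^sup>\<dagger> \<cdot> (l X)\<^sup>\<dagger> \<cdot> W))"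
    using m by (simp add: cod.adj_mult cod.adj_adj cod.mem op_assoc)
  also have "\<dots> = \<tau> (W\<^sup>\<dagger> \<cdot> (l X)\<^sup>\<dagger> \<cdot> W \<cdot> (r Y)\<^sup>\<dagger>)"
    using m by (intro cod.trace_cyclic) (simp_all add: cod.mem)
  finally show ?thesis using assms by (simp add: corr_def l.map_adj r.map_adj)
qed

text \<open>Absorbing \<open>S\<close> into \<open>W\<close> reduces pairings with \<open>S Q S\<close> to pairings with \<open>Q\<close>.\<close>

lemma corr_conj_right:
  assumes "W \<in> B" "X \<in> A" "Y \<in> A" "S \<in> A" "S\<^sup>\<dagger> = S"
  shows "corr W X (S \<cdot> Y \<cdot> S) = corr (W \<cdot> r S) X Y"
proof -
  note m = assms l.map_mem[OF assms(2)] r.map_mem[OF assms(3)] r.map_mem[OF assms(4)]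
  have rS: "(r S)\<^sup>\<dagger> = r S" using assms r.map_adj[of S] by simp
  have "corr W X (S \<cdot> Y \<cdot> S) = \<tau> (W\<^sup>\<dagger> \<cdot> l X \<cdot> W \<cdot> r S \<cdot> r Y \<cdot> r S)"
    using assms by (simp add: corr_def r.map_mult dom.mem op_assoc)
  also have "\<dots> = \<tau> (r S \<cdot> (W\<^sup>\<dagger> \<cdot> l X \<cdot> W \<cdot> r S \<cdot> r Y))"
    using m by (intro cod.trace_cyclic) (simp_all add: cod.mem)
  finally show ?thesis using m by (simp add: corr_def cod.adj_mult rS op_assoc)
qed

text \<open>For rank-one matrices \<open>z\<^sub>i\<^sup>\<dagger> z\<^sub>j\<close> and \<open>w\<^sub>j\<^sup>\<dagger> w\<^sub>i\<close> the pairing is \<open>\<tau> (G\<^sup>\<dagger> G)\<close> with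
  \<open>G = \<Sum>j. l z\<^sub>j W r w\<^sub>j\<^sup>\<dagger>\<close>.\<close>

lemma corr_rank_one:
  assumes W: "W \<in> B" and z: "\<And>i. i < m \<Longrightarrow> z i \<in> A" and w: "\<And>i. i < m \<Longrightarrow> w i \<in> A"
  shows "0 \<le> Re (\<Sum>i<m. \<Sum>j<m. corr W ((z i)\<^sup>\<dagger> \<cdot> z j) ((w j)\<^sup>\<dagger> \<cdot> w i))"
proof -
  define G where "G j = l (z j) \<cdot> W \<cdot> (r (w j))\<^sup>\<dagger>" for j
  have G: "G j \<in> B" if "j < m" for j
    using that assms by (simp add: G_def cod.mem l.map_mem r.map_mem)
  have "corr W ((z i)\<^sup>\<dagger> \<cdot> z j) ((w j)\<^sup>\<dagger> \<cdot> w i) = \<tau> ((G i)\<^sup>\<dagger> \<cdot> G j)" if "i < m" "j < m" for i j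
  proof -
    have mem: "z i \<in> A" "z j \<in> A" "w i \<in> A" "w j \<in> A"
      "l (z i) \<in> B" "l (z j) \<in> B" "r (w i) \<in> B" "r (w j) \<in> B"
      using that z w l.map_mem r.map_mem by auto
    have "corr W ((z i)\<^sup>\<dagger> \<cdot> z j) ((w j)\<^sup>\<dagger> \<cdot> w i) =
      \<tau> (W\<^sup>\<dagger> \<cdot> (l (z i))\<^sup>\<dagger> \<cdot> l (z j) \<cdot> W \<cdot> (r (w j))\<^sup>\<dagger> \<cdot> r (w i))"
      using mem by (simp add: corr_def l.map_mult l.map_adj r.map_mult r.map_adj dom.mem op_assoc)
    also have "\<dots> = \<tau> (r (w i) \<cdot> (W\<^sup>\<dagger> \<cdot> (l (z i))\<^sup>\<dagger> \<cdot> l (z j) \<cdot> W \<cdot> (r (w j))\<^sup>\<dagger>))"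
      using mem W by (intro cod.trace_cyclic) (simp_all add: cod.mem)
    also have "\<dots> = \<tau> ((G i)\<^sup>\<dagger> \<cdot> G j)"
      using mem W by (simp add: G_def cod.adj_mult cod.adj_adj cod.mem op_assoc)
    finally show ?thesis .
  qed
  then have "(\<Sum>i<m. \<Sum>j<m. corr W ((z i)\<^sup>\<dagger> \<cdot> z j) ((w j)\<^sup>\<dagger> \<cdot> w i)) = (\<Sum>i<m. \<Sum>j<m. \<tau> ((G i)\<^sup>\<dagger> \<cdot> G j))"
    by simp
  also have "\<dots> = (\<Sum>i<m. \<tau> (\<Sum>j<m. (G i)\<^sup>\<dagger> \<cdot> G j))"
    using G by (intro sum.cong refl cod.trace_sum[symmetric] cod.mult_mem cod.adj_mem) simp_all
  also have "\<dots> = \<tau> (\<Sum>i<m. \<Sum>j<m. (G i)\<^sup>\<dagger> \<cdot> G j)"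
    using G by (intro cod.trace_sum[symmetric] cod.sum_mem cod.mult_mem cod.adj_mem) simp_all
  also have "(\<Sum>i<m. \<Sum>j<m. (G i)\<^sup>\<dagger> \<cdot> G j) = (\<Sum>i<m. (G i)\<^sup>\<dagger>) \<cdot> (\<Sum>j<m. G j)"
    by (simp only: compose.sum_left) (simp only: compose.sum_right)
  also have "(\<Sum>i<m. (G i)\<^sup>\<dagger>) = (\<Sum>i<m. G i)\<^sup>\<dagger>"
    using G by (intro cod.adj_sum[symmetric]) simp
  finally have eq: "(\<Sum>i<m. \<Sum>j<m. corr W ((z i)\<^sup>\<dagger> \<cdot> z j) ((w j)\<^sup>\<dagger> \<cdot> w i)) =
    \<tau> ((\<Sum>i<m. G i)\<^sup>\<dagger> \<cdot> (\<Sum>j<m. G j))" .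
  have "(\<Sum>i<m. G i) \<in> B" using G by (intro cod.sum_mem) simp
  then show ?thesis unfolding eq using cod.trace_square by blast
qed

lemma corr_positive_strict:
  assumes W: "W \<in> B" and "0 < \<epsilon>"
    and P: "\<And>i j. i < m \<Longrightarrow> j < m \<Longrightarrow> P i j \<in> A" "matrix_bounded_below m \<epsilon> P"
    and Q: "\<And>i j. i < m \<Longrightarrow> j < m \<Longrightarrow> Q i j \<in> A" "matrix_bounded_below m \<epsilon> Q"
  shows "0 \<le> Re (\<Sum>i<m. \<Sum>j<m. corr W (P i j) (Q j i))"
proof -
  obtain z where z: "\<And>k i. k < m \<Longrightarrow> i < m \<Longrightarrow> z k i \<in> A"
    and P_eq: "\<And>i j. i < m \<Longrightarrow> j < m \<Longrightarrow> P i j = (\<Sum>k<m. (z k i)\<^sup>\<dagger> \<cdot> z k j)"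
    using dom.cholesky[OF assms(2) P] by blast
  obtain w where w: "\<And>k i. k < m \<Longrightarrow> i < m \<Longrightarrow> w k i \<in> A"
    and Q_eq: "\<And>i j. i < m \<Longrightarrow> j < m \<Longrightarrow> Q i j = (\<Sum>k<m. (w k i)\<^sup>\<dagger> \<cdot> w k j)"
    using dom.cholesky[OF assms(2) Q] by blast
  let ?t = "\<lambda>k n i j. corr W ((z k i)\<^sup>\<dagger> \<cdot> z k j) ((w n j)\<^sup>\<dagger> \<cdot> w n i)"
  have "(\<Sum>i<m. \<Sum>j<m. corr W (P i j) (Q j i)) = (\<Sum>i<m. \<Sum>j<m. \<Sum>k<m. \<Sum>n<m. ?t k n i j)"
  proof (intro sum.cong refl)
    fix i j assume "i \<in> {..<m}" "j \<in> {..<m}"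
    then have ij: "i < m" "j < m" by simp_all
    have zz: "(z k i)\<^sup>\<dagger> \<cdot> z k j \<in> A" and ww: "(w k j)\<^sup>\<dagger> \<cdot> w k i \<in> A" if "k \<in> {..<m}" for k
      using that ij z w by (simp_all add: dom.mem)
    show "corr W (P i j) (Q j i) = (\<Sum>k<m. \<Sum>n<m. ?t k n i j)"
      unfolding P_eq[OF ij] Q_eq[OF ij(2,1)]
      by (subst corr_sum_left[OF W zz dom.sum_mem[OF ww]]) (auto intro!: sum.cong corr_sum_right W zz ww)
  qed
  also have "\<dots> = (\<Sum>i<m. \<Sum>k<m. \<Sum>n<m. \<Sum>j<m. ?t k n i j)"
    by (rule sum.cong[OF refl], rule trans[OF sum.swap], rule sum.cong[OF refl], rule sum.swap)
  also have "\<dots> = (\<Sum>k<m. \<Sum>n<m. \<Sum>i<m. \<Sum>j<m. ?t k n i j)"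
    by (rule trans[OF sum.swap], rule sum.cong[OF refl], rule sum.swap)
  finally have "Re (\<Sum>i<m. \<Sum>j<m. corr W (P i j) (Q j i)) =
      (\<Sum>k<m. \<Sum>n<m. Re (\<Sum>i<m. \<Sum>j<m. ?t k n i j))"
    by simp
  also have "0 \<le> \<dots>"
    by (intro sum_nonneg corr_rank_one[OF W] z w) simp_all
  finally show ?thesis .
qed

text \<open>Shift both matrices by \<open>\<epsilon>\<close> times the identity, decompose them into rank-one matrices, and let
  \<open>\<epsilon> \<rightarrow> 0\<close>.\<close>

lemma corr_positive:
  assumes W: "W \<in> B" and P: "P \<in> matrices_psd m A" and Q: "Q \<in> matrices_psd m A"
  shows "0 \<le> Re (\<Sum>i<m. \<Sum>j<m. corr W (P i j) (Q j i))"
proof -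
  have memP: "P i j \<in> A" and memQ: "Q i j \<in> A" if "i < m" "j < m" for i j
    using that P Q by (simp_all add: matrices_psd_def matrices_over_def)
  have bP: "matrix_bounded_below m 0 P" and bQ: "matrix_bounded_below m 0 Q"
    using P Q by (simp_all add: matrices_psd_iff)
  define \<delta> where "\<delta> i j = (if i = j then 1 else (0::complex))" for i j :: nat
  let ?sh = "\<lambda>\<epsilon> F i j. F i j + (if i = j then \<epsilon> else 0) *\<^sub>R (\<one> :: 'h op)"
  let ?a = "\<Sum>i<m. \<Sum>j<m. corr W (P i j) (Q j i)"
  let ?b = "\<Sum>i<m. \<Sum>j<m. \<delta> i j * (corr W \<one> (Q j i) + corr W (P i j) \<one>)"
  let ?c = "\<Sum>i<m. \<Sum>j<m. \<delta> i j * corr W \<one> \<one>"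
  have "0 \<le> Re ?a + \<epsilon> * Re ?b + \<epsilon>\<^sup>2 * Re ?c" if "0 < \<epsilon>" for \<epsilon>
  proof -
    have "corr W (?sh \<epsilon> P i j) (?sh \<epsilon> Q j i) = corr W (P i j) (Q j i)
      + complex_of_real \<epsilon> * (\<delta> i j * (corr W \<one> (Q j i) + corr W (P i j) \<one>))
      + complex_of_real (\<epsilon>\<^sup>2) * (\<delta> i j * corr W \<one> \<one>)" if "i < m" "j < m" for i j
      using that W memP memQ
      by (simp add: \<delta>_def corr_add_left corr_add_right corr_scaleR_left corr_scaleR_right dom.mem
          power2_eq_square algebra_simps)
    then have "(\<Sum>i<m. \<Sum>j<m. corr W (?sh \<epsilon> P i j) (?sh \<epsilon> Q j i)) =
      ?a + complex_of_real \<epsilon> * ?b + complex_of_real (\<epsilon>\<^sup>2) * ?c"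
      by (simp add: sum.distrib sum_distrib_left del: of_real_power)
    then have "Re (\<Sum>i<m. \<Sum>j<m. corr W (?sh \<epsilon> P i j) (?sh \<epsilon> Q j i)) = Re ?a + \<epsilon> * Re ?b + \<epsilon>\<^sup>2 * Re ?c"
      by (simp del: of_real_power Re_sum)
    moreover have "0 \<le> Re (\<Sum>i<m. \<Sum>j<m. corr W (?sh \<epsilon> P i j) (?sh \<epsilon> Q j i))"
      using memP memQ
      by (intro corr_positive_strict[OF W that] matrix_bounded_below_shift bP bQ)
        (simp_all add: dom.mem)
    ultimately show ?thesis by simp
  qed
  then show ?thesis by (rule nonneg_if_perturbation_nonneg)
qed

end

lemma (in vn_alg) matrices_psd_adj:
  assumes "P \<in> matrices_psd m M" "i < m" "j < m"
  shows "(P j i)\<^sup>\<dagger> = P i j"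
  using assms
  by (intro adj_eqI matrix_real_form_adjoint mem_complex_linear)
    (auto simp: matrices_psd_iff matrix_bounded_below_def matrices_over_def)

lemma (in vn_alg) matrices_psd_mem:
  "P \<in> matrices_psd m M \<Longrightarrow> i < m \<Longrightarrow> j < m \<Longrightarrow> P i j \<in> M"
  by (simp add: matrices_psd_iff matrices_over_def)

lemma (in vn_alg) matrices_psd_conj:
  assumes Q: "Q \<in> matrices_psd m M" and Y: "Y \<in> M"
  shows "(\<lambda>i j. Y \<cdot> Q i j \<cdot> Y\<^sup>\<dagger>) \<in> matrices_psd m M" (is "?Q \<in> _")
proof -
  have adj: "cinner u (Y x) = cinner ((Y\<^sup>\<dagger>) u) x" for u x
    using is_adjoint_adj[OF Y] unfolding is_adjoint_def by (metis cinner_commute)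
  have "matrix_form m ?Q v = matrix_form m Q (\<lambda>i. (Y\<^sup>\<dagger>) (v i))" for v
    by (simp add: matrix_form_def adj flip: blinfun.sum_right)
  then have "matrix_bounded_below m 0 ?Q"
    using Q by (simp add: matrices_psd_iff matrix_bounded_below_def)
  moreover have "?Q \<in> matrices_over m M"
    using Q Y by (simp add: matrices_psd_iff matrices_over_def mem)
  ultimately show ?thesis by (simp add: matrices_psd_iff)
qed

text \<open>If \<open>P\<close> and \<open>Q\<close> are positive and orthogonal, then \<open>P\<close> paired with \<open>(\<one> + t X) Q (\<one> + t X)\<^sup>\<dagger>\<close>
  is non-negative and vanishes at \<open>t = 0\<close>, so its derivative there vanishes for every \<open>X\<close>.\<close>

lemma (in traced_vn_alg) orthogonal_psd_product_zero:
  assumes S: "S \<in> M" "strictly_positive S"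
    and P: "P \<in> matrices_psd m M" and Q: "Q \<in> matrices_psd m M"
    and orth: "(\<Sum>i<m. \<Sum>j<m. \<tau> (P j i \<cdot> S \<cdot> Q i j \<cdot> S)) = 0"
  shows "(\<Sum>i<m. \<Sum>j<m. P j i \<cdot> S \<cdot> Q i j) = 0"
proof -
  interpret id: traced_hom_pair M M \<tau> "\<lambda>X. X" "\<lambda>X. X"
    by unfold_locales (simp_all add: unital_star_hom_def)
  have memP: "P i j \<in> M" and memQ: "Q i j \<in> M" if "i < m" "j < m" for i j
    using that P Q matrices_psd_mem by auto
  have Sadj: "S\<^sup>\<dagger> = S" using S adj_psd strictly_positive_def by blast
  have corr: "id.corr S X Y = \<tau> (S \<cdot> X \<cdot> S \<cdot> Y)" for X Y by (simp add: id.corr_def Sadj)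
  define N where "N = (\<Sum>i<m. \<Sum>j<m. S \<cdot> P i j \<cdot> S \<cdot> Q j i)"
  have N: "N \<in> M" unfolding N_def using S memP memQ by (intro sum_mem mult_mem) auto
  have "(\<Sum>i<m. \<Sum>j<m. id.corr S (P i j) (Q j i)) = (\<Sum>j<m. \<Sum>i<m. id.corr S (P i j) (Q j i))"
    by (rule sum.swap)
  also have "\<dots> = (\<Sum>i<m. \<Sum>j<m. \<tau> (P j i \<cdot> S \<cdot> Q i j \<cdot> S))"
  proof (intro sum.cong refl)
    fix i j assume "i \<in> {..<m}" "j \<in> {..<m}"
    then have "\<tau> (S \<cdot> (P j i \<cdot> S \<cdot> Q i j)) = \<tau> (P j i \<cdot> S \<cdot> Q i j \<cdot> S)"
      using S memP memQ by (intro trace_cyclic) (simp_all add: mem)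
    then show "id.corr S (P j i) (Q i j) = \<tau> (P j i \<cdot> S \<cdot> Q i j \<cdot> S)" by (simp add: corr op_assoc)
  qed
  finally have zero: "(\<Sum>i<m. \<Sum>j<m. id.corr S (P i j) (Q j i)) = 0" using orth by simp
  have "2 * Re (\<Sum>i<m. \<Sum>j<m. id.corr S (P i j) (Q j i \<cdot> X\<^sup>\<dagger>)) = 0" if X: "X \<in> M" for X
  proof (rule linear_coefficient_zero)
    fix t :: real
    let ?Y = "\<one> + t *\<^sub>R X"
    let ?b = "\<Sum>i<m. \<Sum>j<m. id.corr S (P i j) (Q j i \<cdot> X\<^sup>\<dagger>)"
    let ?b' = "\<Sum>i<m. \<Sum>j<m. id.corr S (P i j) (X \<cdot> Q j i)"
    let ?c = "\<Sum>i<m. \<Sum>j<m. id.corr S (P i j) (X \<cdot> Q j i \<cdot> X\<^sup>\<dagger>)"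
    have "?b' = (\<Sum>j<m. \<Sum>i<m. id.corr S (P i j) (X \<cdot> Q j i))" by (rule sum.swap)
    also have "\<dots> = (\<Sum>i<m. \<Sum>j<m. cnj (id.corr S (P i j) (Q j i \<cdot> X\<^sup>\<dagger>)))"
    proof (intro sum.cong refl)
      fix i j assume "i \<in> {..<m}" "j \<in> {..<m}"
      then show "id.corr S (P j i) (X \<cdot> Q i j) = cnj (id.corr S (P i j) (Q j i \<cdot> X\<^sup>\<dagger>))"
        using S X memP memQ matrices_psd_adj[OF P] matrices_psd_adj[OF Q]
        by (simp add: id.corr_adj[symmetric] mem adj_mult adj_adj)
    qed
    finally have b': "Re ?b' = Re ?b" by simp
    have expand: "id.corr S (P i j) (?Y \<cdot> Q j i \<cdot> ?Y\<^sup>\<dagger>) = id.corr S (P i j) (Q j i)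
        + complex_of_real t * (id.corr S (P i j) (Q j i \<cdot> X\<^sup>\<dagger>) + id.corr S (P i j) (X \<cdot> Q j i))
        + complex_of_real (t\<^sup>2) * id.corr S (P i j) (X \<cdot> Q j i \<cdot> X\<^sup>\<dagger>)"
      if "i < m" "j < m" for i j
    proof -
      have "?Y \<cdot> Q j i \<cdot> ?Y\<^sup>\<dagger> =
          Q j i + t *\<^sub>R (Q j i \<cdot> X\<^sup>\<dagger> + X \<cdot> Q j i) + t\<^sup>2 *\<^sub>R (X \<cdot> Q j i \<cdot> X\<^sup>\<dagger>)"
        using X by (simp add: adj_add adj_one adj_scaleR mem op_distribs op_assoc power2_eq_square
            scaleR_add_right)
      then show ?thesis
        using that S X memP memQ
        by (simp add: id.corr_add_right id.corr_scaleR_right mem)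
    qed
    have "(\<Sum>i<m. \<Sum>j<m. id.corr S (P i j) (?Y \<cdot> Q j i \<cdot> ?Y\<^sup>\<dagger>)) =
        complex_of_real t * (?b + ?b') + complex_of_real (t\<^sup>2) * ?c"
      using zero by (simp add: expand sum.distrib sum_distrib_left distrib_left del: of_real_power)
    then have "Re (\<Sum>i<m. \<Sum>j<m. id.corr S (P i j) (?Y \<cdot> Q j i \<cdot> ?Y\<^sup>\<dagger>)) =
        t * (2 * Re ?b) + t\<^sup>2 * Re ?c"
      using b' by (simp del: of_real_power Re_sum)
    moreover have "0 \<le> Re (\<Sum>i<m. \<Sum>j<m. id.corr S (P i j) (?Y \<cdot> Q j i \<cdot> ?Y\<^sup>\<dagger>))"
      using id.corr_positive[OF S(1) P matrices_psd_conj[OF Q, of ?Y]] X by (simp add: mem)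
    ultimately show "0 \<le> t * (2 * Re ?b) + t\<^sup>2 * Re ?c" by simp
  qed
  \<comment> \<open>The direction \<open>X = N\<close> turns the derivative into a multiple of \<open>\<tau> (N N\<^sup>\<dagger>)\<close>.\<close>
  from this[OF N] have "Re (\<Sum>i<m. \<Sum>j<m. \<tau> (S \<cdot> P i j \<cdot> S \<cdot> Q j i \<cdot> N\<^sup>\<dagger>)) = 0"
    by (simp add: corr op_assoc del: Re_sum)
  moreover have "(\<Sum>i<m. \<Sum>j<m. \<tau> (S \<cdot> P i j \<cdot> S \<cdot> Q j i \<cdot> N\<^sup>\<dagger>)) = \<tau> (N \<cdot> N\<^sup>\<dagger>)"
  proof -
    have "N \<cdot> N\<^sup>\<dagger> = (\<Sum>i<m. \<Sum>j<m. S \<cdot> P i j \<cdot> S \<cdot> Q j i \<cdot> N\<^sup>\<dagger>)"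
      by (subst (1) N_def) (simp only: compose.sum_left)
    also have "\<tau> \<dots> = (\<Sum>i<m. \<tau> (\<Sum>j<m. S \<cdot> P i j \<cdot> S \<cdot> Q j i \<cdot> N\<^sup>\<dagger>))"
      using S memP memQ N by (intro trace_sum sum_mem mult_mem adj_mem) auto
    also have "\<dots> = (\<Sum>i<m. \<Sum>j<m. \<tau> (S \<cdot> P i j \<cdot> S \<cdot> Q j i \<cdot> N\<^sup>\<dagger>))"
      using S memP memQ N by (intro sum.cong refl trace_sum mult_mem adj_mem) auto
    finally show ?thesis by simp
  qed
  moreover have "\<tau> (N \<cdot> N\<^sup>\<dagger>) = \<tau> (N\<^sup>\<dagger> \<cdot> N)" using N by (simp add: trace_cyclic mem)
  ultimately have N0: "N = 0" using N by (intro trace_square_zero) simp_all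
  let ?R = "\<Sum>i<m. \<Sum>j<m. P j i \<cdot> S \<cdot> Q i j"
  have "N = (\<Sum>i<m. \<Sum>j<m. S \<cdot> P j i \<cdot> S \<cdot> Q i j)"
    unfolding N_def by (rule sum.swap)
  also have "\<dots> = S \<cdot> ?R" by (simp add: compose.sum_right op_assoc)
  finally have SR: "S \<cdot> ?R = 0" using N0 by simp
  obtain J where J: "S \<cdot> J = \<one>" "J \<cdot> S = \<one>" using strictly_positive_invertible[OF S(2)] .
  have "?R = J \<cdot> (S \<cdot> ?R)" by (simp only: op_assoc[symmetric] J op_one_left)
  then show ?thesis by (simp only: SR blinfun_compose_zero)
qed

section \<open>The energy of one twisted commutator\<close>

text \<open>The eigenvalue of the twist is written \<open>c\<^sup>2\<close> because it is \<open>c\<close> that appears for \<open>\<sigma>\<^sup>1\<^sup>/\<^sup>2\<close>.\<close>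

locale twisted_pair = traced_hom_pair A B \<tau> l r
  for A :: "'h::chilbert_space op set" and B :: "'k::chilbert_space op set" and \<tau>
    and l r :: "'h op \<Rightarrow> 'k op" +
  fixes \<sigma> :: "'h op" and V :: "'k op" and c :: real
  assumes \<sigma>: "\<sigma> \<in> A" "strictly_positive \<sigma>" and V: "V \<in> B" and c: "0 < c"
    and twist: "l \<sigma> \<cdot> V = (c * c) *\<^sub>R (V \<cdot> r \<sigma>)"
begin

abbreviation S :: "'h op" where "S \<equiv> op_sqrt \<sigma>"
abbreviation D :: "'h op \<Rightarrow> 'k op" where "D \<equiv> twisted_deriv V l r"
abbreviation en :: "'h op \<Rightarrow> 'h op \<Rightarrow> complex" where "en \<equiv> half_energy \<tau> \<sigma> V l r"

lemmas S_properties = dom.op_sqrt_properties[OF \<sigma>]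
lemmas S = S_properties(1)

lemma S_adj: "S\<^sup>\<dagger> = S" by (rule dom.adj_psd[OF S_properties(2)])
lemma lS: "l S \<in> B" "(l S)\<^sup>\<dagger> = l S" and rS: "r S \<in> B" "(r S)\<^sup>\<dagger> = r S"
  using S S_adj l.map_mem r.map_mem l.map_adj[OF S] r.map_adj[OF S] by simp_all

lemma twist_sqrt: "l S \<cdot> V = c *\<^sub>R (V \<cdot> r S)"
proof (rule cod.sqrt_intertwines)
  have "l S \<cdot> l S = l \<sigma>" "r S \<cdot> r S = r \<sigma>"
    using S S_properties(3) by (simp_all flip: l.map_mult r.map_mult)
  then show "l S \<cdot> l S \<cdot> V = (c * c) *\<^sub>R (V \<cdot> r S \<cdot> r S)"
    using twist by (simp add: op_assoc)
qed (use S_properties l.map_strictly_positive r.map_strictly_positive lS rS V c in simp_all)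

lemma twist_sqrt_adj: "V\<^sup>\<dagger> \<cdot> l S = c *\<^sub>R (r S \<cdot> V\<^sup>\<dagger>)"
  using arg_cong[OF twist_sqrt, of adj] V lS rS by (simp add: cod.adj_mult cod.adj_scaleR cod.mem)

lemma D_mem: "X \<in> A \<Longrightarrow> D X \<in> B"
  using V by (simp add: twisted_deriv_def cod.mem l.map_mem r.map_mem)

lemma D_add: "X \<in> A \<Longrightarrow> Y \<in> A \<Longrightarrow> D (X + Y) = D X + D Y"
  by (simp add: twisted_deriv_def l.map_add r.map_add op_distribs)

lemma D_scaleC: "X \<in> A \<Longrightarrow> D (op_scaleC a X) = op_scaleC a (D X)"
  using V cod.mem_complex_linear
  by (intro blinfun_eqI)
    (simp add: twisted_deriv_def l.map_scaleC r.map_scaleC op_scaleC_left op_scaleC_right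
      blinfun.diff_left scaleC_diff_right)

lemma D_one: "D \<one> = 0"
  by (simp add: twisted_deriv_def l.map_one r.map_one)

lemma en_eq: "en X Y = \<tau> ((D X)\<^sup>\<dagger> \<cdot> l S \<cdot> D Y \<cdot> r S)"
  by (simp add: half_energy_def)

lemma en_add_left: "X \<in> A \<Longrightarrow> X' \<in> A \<Longrightarrow> Y \<in> A \<Longrightarrow> en (X + X') Y = en X Y + en X' Y"
  and en_add_right: "X \<in> A \<Longrightarrow> Y \<in> A \<Longrightarrow> Y' \<in> A \<Longrightarrow> en X (Y + Y') = en X Y + en X Y'"
  using lS rS
  by (simp_all add: en_eq D_add D_mem cod.adj_add op_distribs cod.trace_add cod.mem)

lemma en_scaleC_left: "X \<in> A \<Longrightarrow> Y \<in> A \<Longrightarrow> en (op_scaleC a X) Y = cnj a * en X Y"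
  and en_scaleC_right: "X \<in> A \<Longrightarrow> Y \<in> A \<Longrightarrow> en X (op_scaleC a Y) = a * en X Y"
  using lS rS
  by (simp_all add: en_eq D_scaleC D_mem cod.adj_scaleC op_scaleC_left op_scaleC_right
      cod.mem_complex_linear cod.trace_scaleC cod.mem)

lemma en_one: "en X \<one> = 0"
  by (simp add: en_eq D_one cod.trace_zero)

lemma en_hermitian:
  assumes "X \<in> A" "Y \<in> A"
  shows "cnj (en X Y) = en Y X"
proof -
  note m = D_mem[OF assms(1)] D_mem[OF assms(2)] lS rS
  have "cnj (en X Y) = \<tau> (((D X)\<^sup>\<dagger> \<cdot> l S \<cdot> D Y \<cdot> r S)\<^sup>\<dagger>)"
    using m by (simp add: en_eq cod.trace_adj cod.mem)
  also have "\<dots> = \<tau> (r S \<cdot> ((D Y)\<^sup>\<dagger> \<cdot> l S \<cdot> D X))"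
    using m by (simp add: cod.adj_mult cod.adj_adj cod.mem op_assoc)
  also have "\<dots> = en Y X"
    unfolding en_eq using m by (intro cod.trace_cyclic) (simp_all add: cod.mem)
  finally show ?thesis .
qed

text \<open>With \<open>R = S\<^sup>1\<^sup>/\<^sup>2\<close> and \<open>Z = l(R) (\<partial> X) r(R)\<close>, the energy of \<open>X\<close> is \<open>\<tau> (Z\<^sup>\<dagger> Z)\<close>.\<close>

lemma en_nonneg:
  assumes "X \<in> A"
  shows "0 \<le> Re (en X X)"
proof -
  let ?R = "op_sqrt S"
  note R = dom.op_sqrt_properties[OF S S_properties(4)]
  have Radj: "?R\<^sup>\<dagger> = ?R" by (rule dom.adj_psd[OF R(2)])
  have lR: "l ?R \<in> B" "(l ?R)\<^sup>\<dagger> = l ?R" and rR: "r ?R \<in> B" "(r ?R)\<^sup>\<dagger> = r ?R"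
    using R(1) Radj l.map_mem r.map_mem l.map_adj[OF R(1)] r.map_adj[OF R(1)] by simp_all
  have lRR: "l S = l ?R \<cdot> l ?R" and rRR: "r S = r ?R \<cdot> r ?R"
    using R(1,3) by (simp_all flip: l.map_mult r.map_mult)
  note m = D_mem[OF assms] lR rR
  let ?Z = "l ?R \<cdot> D X \<cdot> r ?R"
  have "en X X = \<tau> (((D X)\<^sup>\<dagger> \<cdot> l ?R \<cdot> l ?R \<cdot> D X \<cdot> r ?R) \<cdot> r ?R)"
    by (simp only: en_eq lRR rRR op_assoc)
  also have "\<dots> = \<tau> (r ?R \<cdot> ((D X)\<^sup>\<dagger> \<cdot> l ?R \<cdot> l ?R \<cdot> D X \<cdot> r ?R))"
    using m by (intro cod.trace_cyclic) (simp_all add: cod.mem)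
  also have "\<dots> = \<tau> (?Z\<^sup>\<dagger> \<cdot> ?Z)"
    using m by (simp add: cod.adj_mult cod.mem op_assoc)
  finally show ?thesis using cod.trace_square[of ?Z] m by (simp add: cod.mem)
qed

text \<open>Expanding both commutators and moving \<open>S\<close> across \<open>V\<close> with the twist relation. In the first
  two terms both arguments meet in a single product; the other two have the sign that makes the
  form Dirichlet.\<close>

lemma en_expand:
  assumes X: "X \<in> A" and Y: "Y \<in> A"
  shows "en X Y = c * corr V \<one> (S \<cdot> Y \<cdot> S \<cdot> X\<^sup>\<dagger>) + (1 / c) * corr V (X\<^sup>\<dagger> \<cdot> S \<cdot> Y \<cdot> S) \<one>
    - c * corr V Y (S \<cdot> X\<^sup>\<dagger> \<cdot> S) - c * corr V (X\<^sup>\<dagger>) (S \<cdot> Y \<cdot> S)"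
proof -
  let ?X = "X\<^sup>\<dagger>"
  have X': "?X \<in> A" using X by (rule dom.adj_mem)
  note m = V lS(1) rS(1) l.map_mem[OF X'] r.map_mem[OF X'] l.map_mem[OF Y] r.map_mem[OF Y]
  note mm = cod.mult_mem cod.adj_mem cod.diff_mem
  have Vadj: "V\<^sup>\<dagger> \<in> B" using V by (rule cod.adj_mem)
  have DX: "(D X)\<^sup>\<dagger> = r ?X \<cdot> V\<^sup>\<dagger> - V\<^sup>\<dagger> \<cdot> l ?X"
    using X V by (simp add: twisted_deriv_def cod.adj_diff cod.adj_mult cod.mem l.map_mem r.map_mem
        l.map_adj r.map_adj)
  have twist': "V \<cdot> r S = (1 / c) *\<^sub>R (l S \<cdot> V)" using c by (simp add: twist_sqrt)
  have "en X Y = \<tau> (r ?X \<cdot> V\<^sup>\<dagger> \<cdot> l S \<cdot> V \<cdot> r Y \<cdot> r S) - \<tau> (V\<^sup>\<dagger> \<cdot> l ?X \<cdot> l S \<cdot> V \<cdot> r Y \<cdot> r S)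
     - (\<tau> (r ?X \<cdot> V\<^sup>\<dagger> \<cdot> l S \<cdot> l Y \<cdot> V \<cdot> r S) - \<tau> (V\<^sup>\<dagger> \<cdot> l ?X \<cdot> l S \<cdot> l Y \<cdot> V \<cdot> r S))"
    unfolding en_eq DX twisted_deriv_def[of V l r Y] using m Vadj
    by (simp add: op_distribs op_assoc cod.trace_diff mm)
  also have "\<tau> (r ?X \<cdot> V\<^sup>\<dagger> \<cdot> l S \<cdot> V \<cdot> r Y \<cdot> r S) = c * corr V \<one> (S \<cdot> Y \<cdot> S \<cdot> ?X)"
  proof -
    have "r ?X \<cdot> V\<^sup>\<dagger> \<cdot> l S \<cdot> V \<cdot> r Y \<cdot> r S = r ?X \<cdot> V\<^sup>\<dagger> \<cdot> (l S \<cdot> V) \<cdot> r Y \<cdot> r S"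
      by (simp only: op_assoc)
    also have "\<dots> = c *\<^sub>R (r ?X \<cdot> (V\<^sup>\<dagger> \<cdot> V \<cdot> r S \<cdot> r Y \<cdot> r S))"
      unfolding twist_sqrt by (simp add: op_distribs op_assoc)
    also have "\<tau> \<dots> = c * \<tau> (r ?X \<cdot> (V\<^sup>\<dagger> \<cdot> V \<cdot> r S \<cdot> r Y \<cdot> r S))"
      using m Vadj by (intro cod.trace_scaleR mm)
    also have "\<tau> (r ?X \<cdot> (V\<^sup>\<dagger> \<cdot> V \<cdot> r S \<cdot> r Y \<cdot> r S)) = \<tau> (V\<^sup>\<dagger> \<cdot> V \<cdot> r S \<cdot> r Y \<cdot> r S \<cdot> r ?X)"
      using m Vadj by (intro cod.trace_cyclic mm)
    also have "\<dots> = corr V \<one> (S \<cdot> Y \<cdot> S \<cdot> ?X)"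
      using S X' Y by (simp add: corr_def l.map_one r.map_mult dom.mult_mem op_assoc)
    finally show ?thesis .
  qed
  also have "\<tau> (r ?X \<cdot> V\<^sup>\<dagger> \<cdot> l S \<cdot> l Y \<cdot> V \<cdot> r S) = c * corr V Y (S \<cdot> ?X \<cdot> S)"
  proof -
    have "r ?X \<cdot> V\<^sup>\<dagger> \<cdot> l S \<cdot> l Y \<cdot> V \<cdot> r S = r ?X \<cdot> (V\<^sup>\<dagger> \<cdot> l S) \<cdot> l Y \<cdot> V \<cdot> r S"
      by (simp only: op_assoc)
    also have "\<dots> = c *\<^sub>R (r ?X \<cdot> r S \<cdot> (V\<^sup>\<dagger> \<cdot> l Y \<cdot> V \<cdot> r S))"
      unfolding twist_sqrt_adj by (simp add: op_distribs op_assoc)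
    also have "\<tau> \<dots> = c * \<tau> (r ?X \<cdot> r S \<cdot> (V\<^sup>\<dagger> \<cdot> l Y \<cdot> V \<cdot> r S))"
      using m Vadj by (intro cod.trace_scaleR mm)
    also have "\<tau> (r ?X \<cdot> r S \<cdot> (V\<^sup>\<dagger> \<cdot> l Y \<cdot> V \<cdot> r S)) = \<tau> (V\<^sup>\<dagger> \<cdot> l Y \<cdot> V \<cdot> r S \<cdot> (r ?X \<cdot> r S))"
      using m Vadj by (intro cod.trace_cyclic mm)
    also have "\<dots> = corr V Y (S \<cdot> ?X \<cdot> S)"
      using S X' by (simp add: corr_def r.map_mult dom.mult_mem op_assoc)
    finally show ?thesis .
  qed
  also have "\<tau> (V\<^sup>\<dagger> \<cdot> l ?X \<cdot> l S \<cdot> V \<cdot> r Y \<cdot> r S) = c * corr V ?X (S \<cdot> Y \<cdot> S)"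
  proof -
    have "V\<^sup>\<dagger> \<cdot> l ?X \<cdot> l S \<cdot> V \<cdot> r Y \<cdot> r S = V\<^sup>\<dagger> \<cdot> l ?X \<cdot> (l S \<cdot> V) \<cdot> r Y \<cdot> r S"
      by (simp only: op_assoc)
    also have "\<dots> = c *\<^sub>R (V\<^sup>\<dagger> \<cdot> l ?X \<cdot> V \<cdot> (r S \<cdot> r Y \<cdot> r S))"
      unfolding twist_sqrt by (simp add: op_distribs op_assoc)
    also have "\<tau> \<dots> = c * \<tau> (V\<^sup>\<dagger> \<cdot> l ?X \<cdot> V \<cdot> (r S \<cdot> r Y \<cdot> r S))"
      using m Vadj by (intro cod.trace_scaleR mm)
    also have "V\<^sup>\<dagger> \<cdot> l ?X \<cdot> V \<cdot> (r S \<cdot> r Y \<cdot> r S) = V\<^sup>\<dagger> \<cdot> l ?X \<cdot> V \<cdot> r (S \<cdot> Y \<cdot> S)"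
      using S Y by (simp add: r.map_mult dom.mult_mem)
    finally show ?thesis by (simp add: corr_def)
  qed
  also have "\<tau> (V\<^sup>\<dagger> \<cdot> l ?X \<cdot> l S \<cdot> l Y \<cdot> V \<cdot> r S) = (1 / c) * corr V (?X \<cdot> S \<cdot> Y \<cdot> S) \<one>"
  proof -
    have "V\<^sup>\<dagger> \<cdot> l ?X \<cdot> l S \<cdot> l Y \<cdot> V \<cdot> r S = V\<^sup>\<dagger> \<cdot> l ?X \<cdot> l S \<cdot> l Y \<cdot> (V \<cdot> r S)"
      by (simp only: op_assoc)
    also have "\<dots> = (1 / c) *\<^sub>R (V\<^sup>\<dagger> \<cdot> (l ?X \<cdot> l S \<cdot> l Y \<cdot> l S) \<cdot> V)"
      unfolding twist' by (simp only: op_distribs op_assoc)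
    also have "\<tau> \<dots> = complex_of_real (1 / c) * \<tau> (V\<^sup>\<dagger> \<cdot> (l ?X \<cdot> l S \<cdot> l Y \<cdot> l S) \<cdot> V)"
      using m Vadj by (intro cod.trace_scaleR mm)
    also have "l ?X \<cdot> l S \<cdot> l Y \<cdot> l S = l (?X \<cdot> S \<cdot> Y \<cdot> S)"
      using S X' Y by (simp add: l.map_mult dom.mult_mem)
    finally show ?thesis by (simp add: corr_def r.map_one)
  qed
  finally show ?thesis by (simp add: algebra_simps)
qed

text \<open>For orthogonal positive matrices the terms in which both arguments meet vanish, because
  \<open>\<Sum>i j. P\<^sub>j\<^sub>i S Q\<^sub>i\<^sub>j = 0\<close>; the two remaining ones are pairings of positive matrices.\<close>

lemma en_orthogonal_psd:
  assumes P: "P \<in> matrices_psd m A" and Q: "Q \<in> matrices_psd m A"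
    and prod_zero: "(\<Sum>i<m. \<Sum>j<m. P j i \<cdot> S \<cdot> Q i j) = 0"
  shows "Re (\<Sum>i<m. \<Sum>j<m. en (P i j) (Q i j)) \<le> 0"
proof -
  have memP: "P i j \<in> A" and memQ: "Q i j \<in> A" and adjP: "(P j i)\<^sup>\<dagger> = P i j" and adjQ: "(Q j i)\<^sup>\<dagger> = Q i j"
    if "i < m" "j < m" for i j
    using that P Q dom.matrices_psd_mem dom.matrices_psd_adj by auto
  let ?N = "\<Sum>i<m. \<Sum>j<m. P j i \<cdot> S \<cdot> Q i j"
  have first: "(\<Sum>i<m. \<Sum>j<m. corr V \<one> (S \<cdot> Q i j \<cdot> S \<cdot> P j i)) = 0"
  proof -
    have "(\<Sum>i<m. \<Sum>j<m. corr V \<one> (S \<cdot> Q i j \<cdot> S \<cdot> P j i)) =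
        (\<Sum>i<m. corr V \<one> (\<Sum>j<m. S \<cdot> Q i j \<cdot> S \<cdot> P j i))"
      using S V memP memQ
      by (intro sum.cong refl corr_sum_right[symmetric] dom.mult_mem dom.one_mem) auto
    also have "\<dots> = corr V \<one> (\<Sum>i<m. \<Sum>j<m. S \<cdot> Q i j \<cdot> S \<cdot> P j i)"
      using S V memP memQ
      by (intro corr_sum_right[symmetric] dom.sum_mem dom.mult_mem dom.one_mem) auto
    also have "(\<Sum>i<m. \<Sum>j<m. S \<cdot> Q i j \<cdot> S \<cdot> P j i) = (\<Sum>j<m. \<Sum>i<m. S \<cdot> Q i j \<cdot> S \<cdot> P j i)"
      by (rule sum.swap)
    also have "\<dots> = (\<Sum>j<m. \<Sum>i<m. (P i j \<cdot> S \<cdot> Q j i \<cdot> S)\<^sup>\<dagger>)"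
      using S memP memQ
      by (intro sum.cong refl) (simp add: dom.adj_mult dom.mult_mem S_adj adjP adjQ op_assoc)
    also have "\<dots> = (\<Sum>j<m. (\<Sum>i<m. P i j \<cdot> S \<cdot> Q j i \<cdot> S)\<^sup>\<dagger>)"
      using S memP memQ by (intro sum.cong refl dom.adj_sum[symmetric] dom.mult_mem) auto
    also have "\<dots> = (\<Sum>j<m. \<Sum>i<m. P i j \<cdot> S \<cdot> Q j i \<cdot> S)\<^sup>\<dagger>"
      using S memP memQ by (intro dom.adj_sum[symmetric] dom.sum_mem dom.mult_mem) auto
    also have "(\<Sum>j<m. \<Sum>i<m. P i j \<cdot> S \<cdot> Q j i \<cdot> S) = ?N \<cdot> S"
      by (simp only: compose.sum_left)
    finally show ?thesis by (simp add: prod_zero dom.adj_zero corr_zero)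
  qed
  have second: "(\<Sum>i<m. \<Sum>j<m. corr V (P j i \<cdot> S \<cdot> Q i j \<cdot> S) \<one>) = 0"
  proof -
    have "(\<Sum>i<m. \<Sum>j<m. corr V (P j i \<cdot> S \<cdot> Q i j \<cdot> S) \<one>) =
        (\<Sum>i<m. corr V (\<Sum>j<m. P j i \<cdot> S \<cdot> Q i j \<cdot> S) \<one>)"
      using S V memP memQ
      by (intro sum.cong refl corr_sum_left[symmetric] dom.mult_mem dom.one_mem) auto
    also have "\<dots> = corr V (\<Sum>i<m. \<Sum>j<m. P j i \<cdot> S \<cdot> Q i j \<cdot> S) \<one>"
      using S V memP memQ
      by (intro corr_sum_left[symmetric] dom.sum_mem dom.mult_mem dom.one_mem) auto
    also have "(\<Sum>i<m. \<Sum>j<m. P j i \<cdot> S \<cdot> Q i j \<cdot> S) = ?N \<cdot> S"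
      by (simp only: compose.sum_left)
    finally show ?thesis by (simp add: prod_zero corr_zero)
  qed
  have W: "V \<cdot> r S \<in> B" using V rS by (simp add: cod.mult_mem)
  have pos: "0 \<le> Re (\<Sum>i<m. \<Sum>j<m. corr V (F i j) (S \<cdot> G j i \<cdot> S))"
    if F: "F \<in> matrices_psd m A" and G: "G \<in> matrices_psd m A" for F G
  proof -
    have "(\<Sum>i<m. \<Sum>j<m. corr V (F i j) (S \<cdot> G j i \<cdot> S)) =
        (\<Sum>i<m. \<Sum>j<m. corr (V \<cdot> r S) (F i j) (G j i))"
      using F G dom.matrices_psd_mem S S_adj V
      by (intro sum.cong refl corr_conj_right) auto
    then show ?thesis using corr_positive[OF W F G] by simp
  qed
  have third: "0 \<le> Re (\<Sum>i<m. \<Sum>j<m. corr V (Q i j) (S \<cdot> P j i \<cdot> S))"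
    by (rule pos[OF Q P])
  have "(\<Sum>i<m. \<Sum>j<m. corr V (P j i) (S \<cdot> Q i j \<cdot> S)) = (\<Sum>i<m. \<Sum>j<m. corr V (P i j) (S \<cdot> Q j i \<cdot> S))"
    by (rule sum.swap)
  then have fourth: "0 \<le> Re (\<Sum>i<m. \<Sum>j<m. corr V (P j i) (S \<cdot> Q i j \<cdot> S))"
    using pos[OF P Q] by simp
  have "(\<Sum>i<m. \<Sum>j<m. en (P i j) (Q i j)) = (\<Sum>i<m. \<Sum>j<m.
      c * corr V \<one> (S \<cdot> Q i j \<cdot> S \<cdot> P j i) + (1 / c) * corr V (P j i \<cdot> S \<cdot> Q i j \<cdot> S) \<one>
      - c * corr V (Q i j) (S \<cdot> P j i \<cdot> S) - c * corr V (P j i) (S \<cdot> Q i j \<cdot> S))"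
    using memP memQ by (intro sum.cong refl) (simp add: en_expand adjP)
  also have "\<dots> = c * (\<Sum>i<m. \<Sum>j<m. corr V \<one> (S \<cdot> Q i j \<cdot> S \<cdot> P j i))
      + (1 / c) * (\<Sum>i<m. \<Sum>j<m. corr V (P j i \<cdot> S \<cdot> Q i j \<cdot> S) \<one>)
      - c * (\<Sum>i<m. \<Sum>j<m. corr V (Q i j) (S \<cdot> P j i \<cdot> S))
      - c * (\<Sum>i<m. \<Sum>j<m. corr V (P j i) (S \<cdot> Q i j \<cdot> S))"
    by (simp only: sum.distrib sum_subtractf sum_distrib_left)
  finally have "Re (\<Sum>i<m. \<Sum>j<m. en (P i j) (Q i j)) =
      - c * Re (\<Sum>i<m. \<Sum>j<m. corr V (Q i j) (S \<cdot> P j i \<cdot> S))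
      - c * Re (\<Sum>i<m. \<Sum>j<m. corr V (P j i) (S \<cdot> Q i j \<cdot> S))"
    unfolding first second by (simp del: Re_sum)
  moreover have "0 \<le> c * Re (\<Sum>i<m. \<Sum>j<m. corr V (Q i j) (S \<cdot> P j i \<cdot> S))"
    "0 \<le> c * Re (\<Sum>i<m. \<Sum>j<m. corr V (P j i) (S \<cdot> Q i j \<cdot> S))"
    using third fourth c by (intro mult_nonneg_nonneg; simp)+
  ultimately show ?thesis by linarith
qed

end


section \<open>Two conjugate twisted commutators\<close>

text \<open>By cyclicity of the trace, conjugacy of the two pairs says that their correlation forms, taken
  at \<open>V\<close> and at \<open>V\<^sup>\<dagger>\<close>, are obtained from each other by exchanging the arguments.\<close>

locale conjugate_pairs = fwd: twisted_pair A B \<tau> l r \<sigma> V c +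
    bwd: twisted_pair A B \<tau> l' r' \<sigma> "V\<^sup>\<dagger>" "1 / c"
  for A :: "'h::chilbert_space op set" and B :: "'k::chilbert_space op set" and \<tau>
    and l r l' r' :: "'h op \<Rightarrow> 'k op" and \<sigma> V c +
  assumes corr_swap: "X \<in> A \<Longrightarrow> Y \<in> A \<Longrightarrow> bwd.corr (V\<^sup>\<dagger>) Y X = fwd.corr V X Y"
begin

abbreviation S :: "'h op" where "S \<equiv> op_sqrt \<sigma>"
abbreviation E :: "'h op \<Rightarrow> 'h op \<Rightarrow> complex" where "E \<equiv> energy \<tau> \<sigma> V l r l' r'"

lemma E_eq: "E X Y = fwd.en X Y + bwd.en X Y"
  by (simp add: energy_def)

lemma E_hermitian: "X \<in> A \<Longrightarrow> Y \<in> A \<Longrightarrow> cnj (E X Y) = E Y X"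
  by (simp add: E_eq fwd.en_hermitian bwd.en_hermitian)

text \<open>Since the twists are reciprocal, \<open>corr V \<one> (S Y S X\<^sup>\<dagger>)\<close> from one half and
  \<open>corr V \<one> (X\<^sup>\<dagger> S Y S)\<close> from the other occur with the same coefficient \<open>c\<close>, and likewise for the
  terms with \<open>\<one>\<close> in the second slot and \<open>1 / c\<close>. Replacing \<open>X\<close> and \<open>Y\<close> by their adjoints exchanges
  the members of each such couple up to conjugation; the remaining terms are conjugated one by
  one.\<close>

lemma E_adj:
  assumes X: "X \<in> A" and Y: "Y \<in> A"
  shows "E (X\<^sup>\<dagger>) (Y\<^sup>\<dagger>) = cnj (E X Y)"
proof -
  have mem: "X \<in> A" "Y \<in> A" "X\<^sup>\<dagger> \<in> A" "Y\<^sup>\<dagger> \<in> A" "S \<in> A" "\<one> \<in> A"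
    using X Y fwd.S fwd.dom.adj_mem fwd.dom.one_mem by auto
  note adjs = fwd.dom.adj_mult fwd.dom.adj_adj fwd.dom.adj_one fwd.S_adj
  have expand: "E X Y =
      c * fwd.corr V \<one> (S \<cdot> Y \<cdot> S \<cdot> X\<^sup>\<dagger>) + (1 / c) * fwd.corr V (X\<^sup>\<dagger> \<cdot> S \<cdot> Y \<cdot> S) \<one>
      - c * fwd.corr V Y (S \<cdot> X\<^sup>\<dagger> \<cdot> S) - c * fwd.corr V (X\<^sup>\<dagger>) (S \<cdot> Y \<cdot> S)
      + ((1 / c) * fwd.corr V (S \<cdot> Y \<cdot> S \<cdot> X\<^sup>\<dagger>) \<one> + c * fwd.corr V \<one> (X\<^sup>\<dagger> \<cdot> S \<cdot> Y \<cdot> S)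
      - (1 / c) * fwd.corr V (S \<cdot> X\<^sup>\<dagger> \<cdot> S) Y - (1 / c) * fwd.corr V (S \<cdot> Y \<cdot> S) (X\<^sup>\<dagger>))"
    if "X \<in> A" "Y \<in> A" for X Y
  proof -
    have m: "X\<^sup>\<dagger> \<in> A" "S \<in> A" "\<one> \<in> A" using that mem fwd.dom.adj_mem by auto
    show ?thesis
      unfolding E_eq fwd.en_expand[OF that] bwd.en_expand[OF that]
      using that m by (simp add: corr_swap fwd.dom.mult_mem)
  qed
  have conj: "fwd.corr V (Z\<^sup>\<dagger>) (W\<^sup>\<dagger>) = cnj (fwd.corr V Z W)" if "Z \<in> A" "W \<in> A" for Z W
    by (rule fwd.corr_adj[OF fwd.V that])
  have t1: "fwd.corr V \<one> (S \<cdot> Y\<^sup>\<dagger> \<cdot> S \<cdot> X) = cnj (fwd.corr V \<one> (X\<^sup>\<dagger> \<cdot> S \<cdot> Y \<cdot> S))"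
    and t2: "fwd.corr V (X \<cdot> S \<cdot> Y\<^sup>\<dagger> \<cdot> S) \<one> = cnj (fwd.corr V (S \<cdot> Y \<cdot> S \<cdot> X\<^sup>\<dagger>) \<one>)"
    and t3: "fwd.corr V (Y\<^sup>\<dagger>) (S \<cdot> X \<cdot> S) = cnj (fwd.corr V Y (S \<cdot> X\<^sup>\<dagger> \<cdot> S))"
    and t4: "fwd.corr V X (S \<cdot> Y\<^sup>\<dagger> \<cdot> S) = cnj (fwd.corr V (X\<^sup>\<dagger>) (S \<cdot> Y \<cdot> S))"
    and t5: "fwd.corr V (S \<cdot> Y\<^sup>\<dagger> \<cdot> S \<cdot> X) \<one> = cnj (fwd.corr V (X\<^sup>\<dagger> \<cdot> S \<cdot> Y \<cdot> S) \<one>)"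
    and t6: "fwd.corr V \<one> (X \<cdot> S \<cdot> Y\<^sup>\<dagger> \<cdot> S) = cnj (fwd.corr V \<one> (S \<cdot> Y \<cdot> S \<cdot> X\<^sup>\<dagger>))"
    and t7: "fwd.corr V (S \<cdot> X \<cdot> S) (Y\<^sup>\<dagger>) = cnj (fwd.corr V (S \<cdot> X\<^sup>\<dagger> \<cdot> S) Y)"
    and t8: "fwd.corr V (S \<cdot> Y\<^sup>\<dagger> \<cdot> S) X = cnj (fwd.corr V (S \<cdot> Y \<cdot> S) (X\<^sup>\<dagger>))"
    using mem by (simp_all add: conj[symmetric] adjs fwd.dom.mult_mem op_assoc)
  show ?thesis
    unfolding expand[OF mem(3,4)] expand[OF X Y] fwd.dom.adj_adj[OF X] t1 t2 t3 t4 t5 t6 t7 t8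
    by (simp add: algebra_simps)
qed

lemma E_sesquilinear: "sesquilinear_on A E"
  unfolding sesquilinear_on_def E_eq
  by (simp add: fwd.en_add_left fwd.en_add_right bwd.en_add_left bwd.en_add_right
      fwd.en_scaleC_left fwd.en_scaleC_right bwd.en_scaleC_left bwd.en_scaleC_right algebra_simps)

lemma E_conservative: "conservative A E"
  by (simp add: conservative_def E_eq fwd.en_one bwd.en_one)

lemma amplification_E_real:
  assumes F: "F \<in> matrices_self_adjoint m A" and G: "G \<in> matrices_self_adjoint m A"
  shows "amplification m E F G \<in> \<real>"
proof -
  have mem: "F i j \<in> A" "G i j \<in> A" "(F i j)\<^sup>\<dagger> = F j i" "(G i j)\<^sup>\<dagger> = G j i" if "i < m" "j < m" for i j
    using that F G by (simp_all add: matrices_self_adjoint_def matrices_over_def)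
  have "cnj (\<Sum>i<m. \<Sum>j<m. E (F i j) (G i j)) = (\<Sum>i<m. \<Sum>j<m. E (F j i) (G j i))"
    using mem by (simp add: E_adj[symmetric])
  also have "\<dots> = (\<Sum>i<m. \<Sum>j<m. E (F i j) (G i j))" by (rule sum.swap)
  finally have "(\<Sum>i<m. \<Sum>j<m. E (F i j) (G i j)) \<in> \<real>" by (simp add: Reals_cnj_iff)
  then show ?thesis by (simp add: amplification_def Reals_divide)
qed

lemma E_completely_dirichlet: "completely_dirichlet A \<tau>' \<sigma> E"
  if tr: "traced_vn_alg A \<tau>'" for \<tau>'
  unfolding completely_dirichlet_def
proof (intro allI impI)
  fix m :: nat assume m: "1 \<le> m"
  interpret A: traced_vn_alg A \<tau>' by (rule tr)
  let ?H = "matrices_self_adjoint m A"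
  have mem: "F i j \<in> A" if "F \<in> ?H" "i < m" "j < m" for F i j
    using that by (simp add: matrices_self_adjoint_def matrices_over_def)
  have add: "amplification m E (x + y) z = amplification m E x z + amplification m E y z"
    if "x \<in> ?H" "y \<in> ?H" "z \<in> ?H" for x y z
    using mem that
    by (simp add: amplification_def E_eq fwd.en_add_left bwd.en_add_left sum.distrib
        distrib_left[symmetric] add_divide_distrib algebra_simps)
  have scale: "amplification m E (t *\<^sub>R x) y = complex_of_real t * amplification m E x y"
    if "x \<in> ?H" "y \<in> ?H" for t x y
  proof -
    have "E (t *\<^sub>R x i j) (y i j) = complex_of_real t * E (x i j) (y i j)" if "i < m" "j < m" for i j
      using mem[OF \<open>x \<in> ?H\<close> that] mem[OF \<open>y \<in> ?H\<close> that]
      by (simp add: E_eq scaleR_eq_op_scaleC fwd.en_scaleC_left bwd.en_scaleC_left distrib_left)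
    then show ?thesis by (simp add: amplification_def scaleR_fun_def sum_distrib_left)
  qed
  have sym: "amplification m E x y = amplification m E y x" if "x \<in> ?H" "y \<in> ?H" for x y
  proof -
    have "cnj (amplification m E x y) = amplification m E y x"
      using mem that by (simp add: amplification_def E_hermitian)
    then show ?thesis using amplification_E_real[OF that] by (simp add: Reals_cnj_iff)
  qed
  have nonneg: "0 \<le> Re (amplification m E x x)" if "x \<in> ?H" for x
  proof -
    have "0 \<le> (\<Sum>i<m. \<Sum>j<m. Re (E (x i j) (x i j)))"
      using mem[OF that] by (intro sum_nonneg) (simp add: E_eq fwd.en_nonneg bwd.en_nonneg)
    then show ?thesis by (simp add: amplification_def Re_divide_of_nat)
  qed
  have dir: "Re (amplification m E p q) \<le> 0"
    if p: "p \<in> matrices_psd m A" and q: "q \<in> matrices_psd m A"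
      and orth: "amplification m (kms_inner \<tau>' \<sigma>) p q = 0" for p q
  proof -
    have "(\<Sum>i<m. \<Sum>j<m. \<tau>' (p j i \<cdot> S \<cdot> q i j \<cdot> S)) = (\<Sum>i<m. \<Sum>j<m. kms_inner \<tau>' \<sigma> (p i j) (q i j))"
      using fwd.dom.matrices_psd_adj[OF p] by (intro sum.cong refl) (simp add: kms_inner_def)
    also have "\<dots> = 0" using orth m by (simp add: amplification_def)
    finally have prod: "(\<Sum>i<m. \<Sum>j<m. p j i \<cdot> S \<cdot> q i j) = 0"
      by (intro A.orthogonal_psd_product_zero[OF fwd.S fwd.S_properties(4) p q])
    have "Re (\<Sum>i<m. \<Sum>j<m. E (p i j) (q i j)) =
        Re (\<Sum>i<m. \<Sum>j<m. fwd.en (p i j) (q i j)) + Re (\<Sum>i<m. \<Sum>j<m. bwd.en (p i j) (q i j))"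
      by (simp add: E_eq sum.distrib)
    also have "\<dots> \<le> 0"
      using fwd.en_orthogonal_psd[OF p q prod] bwd.en_orthogonal_psd[OF p q prod] by linarith
    finally show ?thesis by (simp add: amplification_def Re_divide_of_nat divide_le_0_iff)
  qed
  show "dirichlet_form ?H (amplification m (kms_inner \<tau>' \<sigma>)) (matrices_psd m A) (amplification m E)"
    unfolding dirichlet_form_def
    using amplification_E_real add scale sym nonneg dir by blast
qed

end


lemma op_inverse_eqI: "X \<cdot> Y = \<one> \<Longrightarrow> Y \<cdot> X = \<one> \<Longrightarrow> op_inverse X = Y"
  unfolding op_inverse_def by (rule the_equality) (auto, metis op_assoc op_one_left op_one_right)

lemma (in traced_hom_pair) twist_relation:
  assumes "\<sigma> \<in> A" "strictly_positive \<sigma>" and eq: "l \<sigma> \<cdot> V \<cdot> op_inverse (r \<sigma>) = t *\<^sub>R V"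
  shows "l \<sigma> \<cdot> V = t *\<^sub>R (V \<cdot> r \<sigma>)"
proof -
  obtain J where J: "J \<in> A" "\<sigma> \<cdot> J = \<one>" "J \<cdot> \<sigma> = \<one>"
    using dom.strictly_positive_inverse[OF assms(1,2)] .
  have rJ: "r \<sigma> \<cdot> r J = \<one>" "r J \<cdot> r \<sigma> = \<one>"
    using J assms(1) r.map_one by (simp_all flip: r.map_mult)
  have "l \<sigma> \<cdot> V = l \<sigma> \<cdot> V \<cdot> r J \<cdot> r \<sigma>" using rJ by (simp add: op_assoc)
  also have "\<dots> = t *\<^sub>R V \<cdot> r \<sigma>" using eq by (simp add: op_inverse_eqI[OF rJ])
  finally show ?thesis by (simp add: compose.scaleR_left)
qed

text \<open>Evaluating the correlation form at \<open>(\<sigma>, \<one>)\<close> and \<open>(\<one>, \<sigma>)\<close> gives the ratio \<open>t\<close> through the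
  first pair and \<open>1 / t'\<close> through the second; the value at \<open>(\<one>, \<sigma>)\<close> is
  \<open>\<tau> ((V r(S))\<^sup>\<dagger> (V r(S)))\<close> with \<open>S = \<sigma>\<^sup>1\<^sup>/\<^sup>2\<close> and does not vanish.\<close>

lemma twists_reciprocal:
  assumes "traced_hom_pair A B \<tau> l r" "traced_hom_pair A B \<tau> l' r'"
    and \<sigma>: "\<sigma> \<in> A" "strictly_positive \<sigma>" and V: "V \<in> B" "V \<noteq> 0"
    and swap: "\<And>X Y. X \<in> A \<Longrightarrow> Y \<in> A \<Longrightarrow>
      traced_hom_pair.corr \<tau> l' r' (V\<^sup>\<dagger>) Y X = traced_hom_pair.corr \<tau> l r V X Y"
    and t: "l \<sigma> \<cdot> V = t *\<^sub>R (V \<cdot> r \<sigma>)" and t': "l' \<sigma> \<cdot> V\<^sup>\<dagger> = t' *\<^sub>R (V\<^sup>\<dagger> \<cdot> r' \<sigma>)"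
  shows "t * t' = 1"
proof -
  interpret fwd: traced_hom_pair A B \<tau> l r by fact
  interpret bwd: traced_hom_pair A B \<tau> l' r' by fact
  have V': "V\<^sup>\<dagger> \<in> B" using V by (simp add: fwd.cod.adj_mem)
  have fwd: "fwd.corr V \<sigma> \<one> = t * fwd.corr V \<one> \<sigma>"
  proof -
    have "V\<^sup>\<dagger> \<cdot> l \<sigma> \<cdot> V = t *\<^sub>R (V\<^sup>\<dagger> \<cdot> V \<cdot> r \<sigma>)" using t by (simp add: op_assoc compose.scaleR_right)
    then show ?thesis
      using V V' \<sigma> by (simp add: fwd.corr_def fwd.l.map_one fwd.r.map_one fwd.cod.trace_scaleR
          fwd.cod.mult_mem fwd.r.map_mem)
  qed
  have bwd: "bwd.corr (V\<^sup>\<dagger>) \<sigma> \<one> = t' * bwd.corr (V\<^sup>\<dagger>) \<one> \<sigma>"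
  proof -
    have "V\<^sup>\<dagger>\<^sup>\<dagger> \<cdot> l' \<sigma> \<cdot> V\<^sup>\<dagger> = t' *\<^sub>R (V\<^sup>\<dagger>\<^sup>\<dagger> \<cdot> V\<^sup>\<dagger> \<cdot> r' \<sigma>)"
      using t' by (simp add: op_assoc compose.scaleR_right)
    then show ?thesis
      using V V' \<sigma> by (simp add: bwd.corr_def bwd.l.map_one bwd.r.map_one fwd.cod.trace_scaleR
          fwd.cod.mult_mem bwd.r.map_mem fwd.cod.adj_adj)
  qed
  let ?q = "fwd.corr V \<one> \<sigma>"
  have "?q = complex_of_real (t * t') * ?q"
    using fwd bwd swap[OF \<sigma>(1) fwd.dom.one_mem] swap[OF fwd.dom.one_mem \<sigma>(1)] by (simp add: mult.commute)
  moreover have "?q \<noteq> 0"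
  proof
    assume q: "?q = 0"
    note S = fwd.dom.op_sqrt_properties[OF \<sigma>]
    let ?S = "op_sqrt \<sigma>" and ?W = "V \<cdot> r (op_sqrt \<sigma>)"
    have W: "?W \<in> B" using V S by (simp add: fwd.cod.mult_mem fwd.r.map_mem)
    have "fwd.corr V \<one> (?S \<cdot> \<one> \<cdot> ?S) = fwd.corr ?W \<one> \<one>"
      using V S fwd.dom.adj_psd fwd.dom.one_mem by (intro fwd.corr_conj_right) auto
    then have "\<tau> (?W\<^sup>\<dagger> \<cdot> ?W) = 0"
      using q S by (simp add: fwd.corr_def[of ?W] fwd.l.map_one fwd.r.map_one)
    then have "?W = 0" using W by (intro fwd.cod.trace_square_zero) simp_all
    moreover obtain J where J: "J \<in> A" "?S \<cdot> J = \<one>"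
      using fwd.dom.strictly_positive_inverse[OF S(1,4)] by metis
    moreover have "V = ?W \<cdot> r J"
      using J S(1) by (simp add: op_assoc fwd.r.map_one flip: fwd.r.map_mult)
    ultimately show False using V by simp
  qed
  ultimately have "complex_of_real (t * t') = 1" by simp
  then show ?thesis by (simp only: of_real_eq_1_iff)
qed

theorem theorem4p6:
  fixes A :: "'h::chilbert_space op set" and B :: "'k::chilbert_space op set"
    and \<tau> :: "'h op \<Rightarrow> complex" and \<tau>\<^sub>B :: "'k op \<Rightarrow> complex"
    and \<sigma> :: "'h op" and V :: "'k op"
    and l r l' r' :: "'h op \<Rightarrow> 'k op" and \<omega> \<omega>' :: real
  assumes "fd_von_neumann_algebra A" and "fd_von_neumann_algebra B"
    and "faithful_tracial_functional A \<tau>" and "faithful_tracial_functional B \<tau>\<^sub>B"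
    and "faithful_density_matrix A \<tau> \<sigma>"
    and "V \<in> B" and "V \<noteq> 0"
    and "\<forall>f\<in>{l, r, l', r'}. unital_star_hom A B f"
    and "\<forall>f\<in>{l, r, l', r'}. trace_compatible A \<tau> \<tau>\<^sub>B f"
    and "\<And>X Y. X \<in> A \<Longrightarrow> Y \<in> A \<Longrightarrow>
           \<tau>\<^sub>B (V\<^sup>\<dagger> \<cdot> l X \<cdot> V \<cdot> r Y) = \<tau>\<^sub>B (V\<^sup>\<dagger> \<cdot> r' X \<cdot> V \<cdot> l' Y)"
    and "l \<sigma> \<cdot> V \<cdot> op_inverse (r \<sigma>) = exp (- \<omega>) *\<^sub>R V"
    and "l' \<sigma> \<cdot> V\<^sup>\<dagger> \<cdot> op_inverse (r' \<sigma>) = exp (- \<omega>') *\<^sub>R V\<^sup>\<dagger>"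
  shows "sesquilinear_on A (energy \<tau>\<^sub>B \<sigma> V l r l' r') \<and>
         conservative A (energy \<tau>\<^sub>B \<sigma> V l r l' r') \<and>
         completely_dirichlet A \<tau> \<sigma> (energy \<tau>\<^sub>B \<sigma> V l r l' r')"
proof -
  interpret A: traced_vn_alg A \<tau>
    using assms by (simp add: traced_vn_alg_def traced_vn_alg_axioms_def vn_alg_if_fd)
  interpret B: traced_vn_alg B \<tau>\<^sub>B
    using assms by (simp add: traced_vn_alg_def traced_vn_alg_axioms_def vn_alg_if_fd)
  have pair: "traced_hom_pair A B \<tau>\<^sub>B f g" if "f \<in> {l, r, l', r'}" "g \<in> {l, r, l', r'}" for f g
  proof -
    have "unital_star_hom A B f" "unital_star_hom A B g" using assms(8) that by blast+
    then show ?thesis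
      by (intro traced_hom_pair.intro vn_hom.intro vn_hom_axioms.intro
          A.vn_alg_axioms B.vn_alg_axioms B.traced_vn_alg_axioms)
  qed
  interpret fwd: traced_hom_pair A B \<tau>\<^sub>B l r by (rule pair) simp_all
  interpret bwd: traced_hom_pair A B \<tau>\<^sub>B l' r' by (rule pair) simp_all
  have \<sigma>: "\<sigma> \<in> A" "strictly_positive \<sigma>"
    using assms(5) strictly_positive_if_left_inverse unfolding faithful_density_matrix_def by blast+
  have V': "V\<^sup>\<dagger> \<in> B" using assms(6) by (rule B.adj_mem)
  have swap: "bwd.corr (V\<^sup>\<dagger>) Y X = fwd.corr V X Y" if "X \<in> A" "Y \<in> A" for X Y
  proof -
    have m: "l' Y \<in> B" "r' X \<in> B" using that bwd.l.map_mem bwd.r.map_mem by auto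
    have "bwd.corr (V\<^sup>\<dagger>) Y X = \<tau>\<^sub>B ((V \<cdot> l' Y) \<cdot> (V\<^sup>\<dagger> \<cdot> r' X))"
      using assms(6) by (simp add: bwd.corr_def B.adj_adj op_assoc)
    also have "\<dots> = \<tau>\<^sub>B ((V\<^sup>\<dagger> \<cdot> r' X) \<cdot> (V \<cdot> l' Y))"
      using m assms(6) V' by (intro B.trace_cyclic B.mult_mem)
    also have "\<dots> = fwd.corr V X Y"
      using assms(10)[OF that] by (simp add: fwd.corr_def op_assoc)
    finally show ?thesis .
  qed
  have t: "l \<sigma> \<cdot> V = exp (- \<omega>) *\<^sub>R (V \<cdot> r \<sigma>)" by (rule fwd.twist_relation[OF \<sigma> assms(11)])
  have t': "l' \<sigma> \<cdot> V\<^sup>\<dagger> = exp (- \<omega>') *\<^sub>R (V\<^sup>\<dagger> \<cdot> r' \<sigma>)" by (rule bwd.twist_relation[OF \<sigma> assms(12)])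
  have "exp (- \<omega>) * exp (- \<omega>') = 1"
    by (rule twists_reciprocal[OF fwd.traced_hom_pair_axioms bwd.traced_hom_pair_axioms
          \<sigma> assms(6,7) swap t t'])
  define c where "c = exp (- \<omega> / 2)"
  have cc: "exp (- \<omega>) = c * c" by (simp add: c_def flip: exp_add)
  have cc': "exp (- \<omega>') = 1 / c * (1 / c)"
    using \<open>exp (- \<omega>) * exp (- \<omega>') = 1\<close> unfolding cc by (simp add: c_def field_simps)
  interpret conjugate_pairs A B \<tau>\<^sub>B l r l' r' \<sigma> V c
  proof unfold_locales
    show "0 < c" "0 < 1 / c" by (simp_all add: c_def)
  qed (use \<sigma> assms(6) V' t t' swap in \<open>simp_all add: cc cc'\<close>)
  show ?thesis
    using E_sesquilinear E_conservative E_completely_dirichlet[OF A.traced_vn_alg_axioms] by blast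
qed

end
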